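(* Let $u_0\in L^\infty(\Omega)$ satisfy $u_0(x)\ge 1$ for a.e. $x\in\Omega$ and $u_0\not\equiv 1$. Let $u$ be the corresponding global solution of Problem $(P)$, let $Y(t;s)$ be the solution of $(ODE)$, and let $\lambda_\infty:=\lim_{t\to\infty}\lambda(t)$. Set $\Omega_1(0):=\{x\in\Omega: u_0(x)=1\}$ and $\Omega_+(0):=\{x\in\Omega: u_0(x)>1\}$. Then: (a) for all $x\in\Omega_1(0)$, $Y(t;u_0(x))\to 1$ as $t\to\infty$; (b) for all $x\in\Omega_+(0)$, $Y(t;u_0(x))\to\lambda_\infty$ as $t\to\infty$. As a consequence, the only element $\varphi$ of $\omega(u_0)$ is given by $$\varphi=\chi_{\Omega_1(0)}+\lambda_\infty\,\chi_{\Omega_+(0)},$$ the value of $\lambda_\infty$ being determined by the equation $$|\Omega_1(0)|+\lambda_\infty|\Omega_+(0)|=\int_\Omega u_0(x)\,dx.$$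
   Context: $\Omega$ is an open bounded subset of $\mathbb{R}^N$, $N\ge 1$; $|A|$ is the Lebesgue measure of $A$ and $\chi_A$ its characteristic function. Set $f(z):=z^2(1-z)$ and $g(z):=z(1-z)$ for $z\in\mathbb{R}$. Problem $(P)$ is the nonlocal differential equation $u_t=u^2(1-u)-\lambda(t)\,u(1-u)$ for $x\in\Omega$, $t\ge 0$, with $u(x,0)=u_0(x)$, where $$\lambda(t):=\frac{\int_\Omega u^2(1-u)(x,t)\,dx}{\int_\Omega u(1-u)(x,t)\,dx}.$$ A (global) solution is a function $u\in C^1([0,\infty);L^\infty(\Omega))$ with $u(0)=u_0$, $\int_\Omega g(u(x,t))\,dx\ne 0$ for all $t\ge 0$, and $u_t(x,t)=f(u(x,t))-\lambda(t)g(u(x,t))$ for a.e. $x\in\Omega$ and all $t\ge0$. Known fact: if $u_0\in L^\infty(\Omega)$, $u_0\ge1$ a.e. and $u_0\not\equiv1$ (not a.e. equal to $1$), then $(P)$ has a global solution $u$, and $1\le u(x,t)\le \operatorname{ess\,sup}_\Omega u_0$ for a.e. $x\in\Omega$ and all $t\ge0$; $u$ and $\lambda$ refer to this solution. Moreover in this case the limit $\lambda_\infty=\lim_{t\to\infty}\lambda(t)$ exists and $\lambda_\infty>1$. With this function $\lambda$, for $s\in\mathbb{R}$, $Y(\cdot;s)$ denotes the unique solution of $(ODE)$: $\dot Y(t)=Y(t)^2(1-Y(t))-\lambda(t)Y(t)(1-Y(t))$, $t>0$, $Y(0)=s$. One has $u(x,t)=Y(t;u_0(x))$ for a.e. $x\in\Omega$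 and all $t\ge0$. A pointwise-defined representative of $u_0$ is fixed. The $\omega$-limit set $\omega(u_0)$ is the set of all $\varphi\in L^1(\Omega)$ for which there is a sequence $(t_n)_{n\ge1}$ with $t_n\to\infty$ and $\|u(t_n)-\varphi\|_{L^1(\Omega)}\to0$ as $n\to\infty$. *)

theory Defs
  imports "HOL-Probability.Probability"
begin

definition f_nl :: "real \<Rightarrow> real" where
  "f_nl z = z\<^sup>2 * (1 - z)"

definition g_nl :: "real \<Rightarrow> real" where
  "g_nl z = z * (1 - z)"

text \<open>
  A measurable function has \<open>ennreal\<close>-valued essential supremum of its absolute value as
  \<open>L\<^sup>\<infinity>\<close>-norm; for a non-measurable function \<open>esssup\<close> is \<open>\<top>\<close> by convention.
  Elements of \<open>L\<^sup>\<infinity>(\<Omega>)\<close> are represented by functions, used only up to equality a.e.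
\<close>

definition Linf_norm :: "(real ^ 'n) set \<Rightarrow> (real ^ 'n \<Rightarrow> real) \<Rightarrow> ennreal" where
  "Linf_norm \<Omega> w = esssup (lebesgue_on \<Omega>) (\<lambda>x. ennreal \<bar>w x\<bar>)"

definition Linf :: "(real ^ 'n) set \<Rightarrow> (real ^ 'n \<Rightarrow> real) set" where
  "Linf \<Omega> = {w. w \<in> borel_measurable (lebesgue_on \<Omega>) \<and> Linf_norm \<Omega> w < \<infinity>}"

text \<open>
  \<open>u \<in> C\<^sup>1([0,\<infinity>); L\<^sup>\<infinity>(\<Omega>))\<close> with time derivative \<open>v\<close>; derivative and continuity are
  one-sided at \<open>t = 0\<close>.
\<close>

definition C1_Linf_deriv ::
  "(real ^ 'n) set \<Rightarrow> (real \<Rightarrow> real ^ 'n \<Rightarrow> real) \<Rightarrow> (real \<Rightarrow> real ^ 'n \<Rightarrow> real) \<Rightarrow> bool" where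
  "C1_Linf_deriv \<Omega> u v \<longleftrightarrow>
     (\<forall>t\<ge>0. u t \<in> Linf \<Omega> \<and> v t \<in> Linf \<Omega> \<and>
        ((\<lambda>s. Linf_norm \<Omega> (\<lambda>x. (u s x - u t x) / (s - t) - v t x)) \<longlongrightarrow> 0) (at t within {0..}) \<and>
        ((\<lambda>s. Linf_norm \<Omega> (\<lambda>x. v s x - v t x)) \<longlongrightarrow> 0) (at t within {0..}))"

definition nonlocal_lambda :: "(real ^ 'n) set \<Rightarrow> (real \<Rightarrow> real ^ 'n \<Rightarrow> real) \<Rightarrow> real \<Rightarrow> real" where
  "nonlocal_lambda \<Omega> u t =
     (LINT x|lebesgue_on \<Omega>. f_nl (u t x)) / (LINT x|lebesgue_on \<Omega>. g_nl (u t x))"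

definition global_solution ::
  "(real ^ 'n) set \<Rightarrow> (real ^ 'n \<Rightarrow> real) \<Rightarrow> (real \<Rightarrow> real ^ 'n \<Rightarrow> real) \<Rightarrow> bool" where
  "global_solution \<Omega> u0 u \<longleftrightarrow>
     (AE x in lebesgue_on \<Omega>. u 0 x = u0 x) \<and>
     (\<forall>t\<ge>0. (LINT x|lebesgue_on \<Omega>. g_nl (u t x)) \<noteq> 0) \<and>
     (\<exists>v. C1_Linf_deriv \<Omega> u v \<and>
       (\<forall>t\<ge>0. AE x in lebesgue_on \<Omega>.
          v t x = f_nl (u t x) - nonlocal_lambda \<Omega> u t * g_nl (u t x)))"

definition solves_ODE :: "(real \<Rightarrow> real) \<Rightarrow> real \<Rightarrow> (real \<Rightarrow> real) \<Rightarrow> bool" where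
  "solves_ODE lam s y \<longleftrightarrow>
     continuous_on {0..} y \<and> y 0 = s \<and>
     (\<forall>t>0. (y has_real_derivative ((y t)\<^sup>2 * (1 - y t) - lam t * y t * (1 - y t))) (at t))"

definition lambda_infty :: "(real ^ 'n) set \<Rightarrow> (real \<Rightarrow> real ^ 'n \<Rightarrow> real) \<Rightarrow> real" where
  "lambda_infty \<Omega> u = Lim at_top (nonlocal_lambda \<Omega> u)"

definition Omega_one :: "(real ^ 'n) set \<Rightarrow> (real ^ 'n \<Rightarrow> real) \<Rightarrow> (real ^ 'n) set" where
  "Omega_one \<Omega> u0 = {x \<in> \<Omega>. u0 x = 1}"

definition Omega_plus :: "(real ^ 'n) set \<Rightarrow> (real ^ 'n \<Rightarrow> real) \<Rightarrow> (real ^ 'n) set" where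
  "Omega_plus \<Omega> u0 = {x \<in> \<Omega>. u0 x > 1}"

text \<open>
  The \<open>\<omega>\<close>-limit set is a subset of \<open>L\<^sup>1(\<Omega>)\<close>; here it is the set of all representatives
  of its elements, hence closed under equality a.e. on \<open>\<Omega>\<close>.
\<close>

definition omega_limit ::
  "(real ^ 'n) set \<Rightarrow> (real \<Rightarrow> real ^ 'n \<Rightarrow> real) \<Rightarrow> (real ^ 'n \<Rightarrow> real) set" where
  "omega_limit \<Omega> u =
     {\<phi>. integrable (lebesgue_on \<Omega>) \<phi> \<and>
        (\<exists>\<tau> :: nat \<Rightarrow> real. (\<forall>n. \<tau> n \<ge> 0) \<and> filterlim \<tau> at_top sequentially \<and>
           (\<lambda>n. LINT x|lebesgue_on \<Omega>. \<bar>u (\<tau> n) x - \<phi> x\<bar>) \<longlonglongrightarrow> 0)}"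

end

theory Submission
  imports Defs
begin

text \<open>
  Along a solution \<open>y > 1\<close> of the ODE, \<open>ln (1 - 1 / y)\<close> has derivative \<open>\<lambda>(t) - y\<close>. Hence for two
  solutions \<open>1 < y \<le> z\<close> the nonnegative quantity \<open>H = ln (1 - 1 / z) - ln (1 - 1 / y)\<close> satisfies
  \<open>H' = y - z \<le> - (y - 1) H\<close>, whatever \<open>\<lambda>\<close> is. If \<open>B\<close> bounds \<open>u\<^sub>0\<close>, conservation of mass
  keeps \<open>Y(t;B)\<close> above the mean of \<open>u\<^sub>0\<close>, which exceeds \<open>1\<close>. As \<open>H\<close> decreases, every \<open>Y(t;s)\<close> with
  \<open>1 < s \<le> B\<close> then stays away from \<open>1\<close>, so \<open>H\<close> decays exponentially and \<open>Y(t;s)\<close> merges with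
  \<open>Y(t;B)\<close>. By dominated convergence, mass conservation forces the common limit, and \<open>\<lambda>(t)\<close>,
  being a weighted mean of \<open>u\<close> over \<open>{u\<^sub>0 > 1}\<close>, has the same limit.
\<close>

section \<open>Gronwall's inequality and comparison of solutions of the ODE\<close>

text \<open>The derivative bound is asked only on the open interval because the ODE is imposed only
  for \<open>t > 0\<close>. \<open>K\<close> may have either sign: decay, monotonicity and growth
  estimates are all drawn from this form.\<close>

lemma gronwall:
  fixes E :: "real \<Rightarrow> real"
  assumes "0 \<le> T" and cont: "continuous_on {0..T} E"
    and deriv: "\<And>t. 0 < t \<Longrightarrow> t < T \<Longrightarrow> \<exists>D. (E has_real_derivative D) (at t) \<and> D \<le> K * E t"
  shows "E T \<le> E 0 * exp (K * T)"
proof (cases "T = 0")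
  case False
  have "E T * exp (- K * T) \<le> E 0 * exp (- K * 0)"
  proof (rule DERIV_nonpos_imp_decreasing_open[where f = "\<lambda>t. E t * exp (- K * t)"])
    fix t assume "0 < t" "t < T"
    then obtain D where D: "(E has_real_derivative D) (at t)" "D \<le> K * E t"
      using deriv by blast
    have "((\<lambda>t. E t * exp (- K * t)) has_real_derivative (D - K * E t) * exp (- K * t)) (at t)"
      by (auto intro!: derivative_eq_intros D simp: algebra_simps)
    moreover have "(D - K * E t) * exp (- K * t) \<le> 0"
      using D(2) by (simp add: mult_nonpos_nonneg)
    ultimately show "\<exists>y. ((\<lambda>t. E t * exp (- K * t)) has_real_derivative y) (at t) \<and> y \<le> 0"
      by blast
  qed (use assms False in \<open>auto intro!: continuous_intros\<close>)
  then show ?thesis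
    by (simp add: exp_minus field_simps)
qed simp

text \<open>The difference \<open>w = z - y\<close> of two solutions satisfies the linear equation \<open>w' = q w\<close>, where \<open>q\<close>
  is the difference quotient of the cubic right-hand side.\<close>

lemma solves_ODE_diff:
  assumes lam: "continuous_on {0..} lam"
    and y: "solves_ODE lam a y" and z: "solves_ODE lam b z" and "0 \<le> t"
  shows "\<exists>k. z t - y t = (b - a) * exp k"
proof (cases "t = 0")
  case True
  then show ?thesis
    using y z by (intro exI[of _ 0]) (simp add: solves_ODE_def)
next
  case False
  with \<open>0 \<le> t\<close> have "0 < t" by simp
  have cont: "continuous_on {0..t} lam" "continuous_on {0..t} y" "continuous_on {0..t} z"
    using lam y z unfolding solves_ODE_def by (auto elim: continuous_on_subset)
  define q where "q \<equiv> \<lambda>r. (1 + lam r) * (z r + y r) - lam r - ((z r)\<^sup>2 + z r * y r + (y r)\<^sup>2)"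
  have q: "continuous_on {0..t} q"
    unfolding q_def by (intro continuous_intros cont)
  define Q where "Q \<equiv> \<lambda>r. integral {0..r} q"
  have Q: "continuous_on {0..t} Q"
    unfolding Q_def by (intro indefinite_integral_continuous_1 integrable_continuous_real q)
  \<comment> \<open>The integrating factor \<open>exp (- Q r)\<close> turns \<open>w' = q w\<close>
    into the statement that \<open>W\<close> is constant.\<close>
  define W where "W \<equiv> \<lambda>r. (z r - y r) * exp (- Q r)"
  have "W t = W 0"
  proof (rule DERIV_isconst_end[where f = W])
    show "continuous_on {0..t} W"
      unfolding W_def by (intro continuous_intros cont Q)
    fix r assume r: "0 < r" "r < t"
    have dy: "(y has_real_derivative ((y r)\<^sup>2 * (1 - y r) - lam r * y r * (1 - y r))) (at r)"
      and dz: "(z has_real_derivative ((z r)\<^sup>2 * (1 - z r) - lam r * z r * (1 - z r))) (at r)"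
      using y z r by (auto simp: solves_ODE_def)
    have "(Q has_real_derivative q r) (at r within {0..t})"
      unfolding Q_def using r by (intro integral_has_real_derivative q) auto
    then have dQ: "(Q has_real_derivative q r) (at r)"
      using r by (simp add: at_within_Icc_at)
    show "(W has_real_derivative 0) (at r)"
      unfolding W_def
      by (rule derivative_eq_intros dy dz dQ refl)+
        (simp add: q_def power2_eq_square algebra_simps)
  qed (use \<open>0 < t\<close> in auto)
  moreover have "W 0 = b - a"
    using y z by (simp add: W_def Q_def solves_ODE_def)
  ultimately have "(z t - y t) * exp (- Q t) = b - a"
    by (metis W_def)
  then show ?thesis
    by (intro exI[of _ "Q t"]) (simp add: exp_minus field_simps)
qed

lemma solves_ODE_const_one: "solves_ODE lam 1 (\<lambda>_. 1)"
  by (auto simp: solves_ODE_def intro!: derivative_eq_intros)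

text \<open>Two solutions differ by a positive multiple of \<open>b - a\<close>, so they never
  cross. The same identity against the equilibrium 1 gives the next two lemmas.\<close>

lemma solves_ODE_mono:
  assumes "continuous_on {0..} lam" "solves_ODE lam a y" "solves_ODE lam b z" "0 \<le> t" "a \<le> b"
  shows "y t \<le> z t"
  using solves_ODE_diff[OF assms(1-4)] \<open>a \<le> b\<close> by (smt (verit) exp_gt_zero mult_nonneg_nonneg)

lemma solves_ODE_gt_one:
  assumes "continuous_on {0..} lam" "solves_ODE lam s y" "0 \<le> t" "1 < s"
  shows "1 < y t"
  using solves_ODE_diff[OF assms(1) solves_ODE_const_one assms(2,3)] \<open>1 < s\<close>
  by (smt (verit) exp_gt_zero mult_pos_pos)

lemma solves_ODE_one:
  assumes "continuous_on {0..} lam" "solves_ODE lam 1 y" "0 \<le> t"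
  shows "y t = 1"
  using solves_ODE_diff[OF assms(1) solves_ODE_const_one assms(2,3)] by auto

section \<open>The logarithmic coordinate and the distance between trajectories\<close>

lemma continuous_on_log_coord:
  assumes "solves_ODE lam s y" "\<And>t. 0 \<le> t \<Longrightarrow> 1 < y t"
  shows "continuous_on {0..} (\<lambda>t. ln (1 - 1 / y t))"
proof -
  have "1 - 1 / y t \<noteq> 0" "y t \<noteq> 0" if "0 \<le> t" for t
    using assms(2)[OF that] by (auto simp: field_simps)
  then show ?thesis
    using assms(1) by (auto simp: solves_ODE_def intro!: continuous_intros)
qed

text \<open>In the coordinate \<open>ln (1 - 1 / y)\<close> the equation becomes \<open>lam - y\<close>, so that the unknown
  \<open>lam\<close> cancels from differences.\<close>

lemma log_coord_deriv:
  assumes y: "solves_ODE lam s y" and t: "0 < t" "1 < y t"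
  shows "((\<lambda>t. ln (1 - 1 / y t)) has_real_derivative (lam t - y t)) (at t)"
proof -
  have dy: "(y has_real_derivative ((y t)\<^sup>2 * (1 - y t) - lam t * y t * (1 - y t))) (at t)"
    using y t by (auto simp: solves_ODE_def)
  have pos: "0 < 1 - 1 / y t" "y t \<noteq> 0" "y t \<noteq> 1"
    using t by (auto simp: field_simps)
  show ?thesis
    by (rule derivative_eq_intros dy refl pos)+
      (use pos in \<open>simp add: field_simps power2_eq_square\<close>)
qed

text \<open>The difference \<open>H\<close> of the two coordinates has derivative
  \<open>y - z\<close>; concavity of \<open>ln\<close> together with \<open>z > 1\<close> gives
  \<open>(y - 1) * H \<le> z - y\<close>, so Gronwall applies with \<open>K = - c\<close>. The case
  \<open>c = 0\<close> says that \<open>H\<close> never grows; it leads to a positive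
  \<open>c\<close>, for which \<open>H\<close> decays exponentially.\<close>

lemma log_ratio_decreasing:
  assumes y: "solves_ODE lam a y" and z: "solves_ODE lam b z" and "0 \<le> t"
    and gt: "\<And>t. 0 \<le> t \<Longrightarrow> 1 < y t" and le: "\<And>t. 0 \<le> t \<Longrightarrow> y t \<le> z t"
    and c: "0 \<le> c" "\<And>t. 0 \<le> t \<Longrightarrow> 1 + c \<le> y t"
  shows "ln (1 - 1 / z t) - ln (1 - 1 / y t) \<le> (ln (1 - 1 / z 0) - ln (1 - 1 / y 0)) * exp (- c * t)"
proof (rule gronwall[where E = "\<lambda>t. ln (1 - 1 / z t) - ln (1 - 1 / y t)"])
  have gt': "1 < z t" if "0 \<le> t" for t
    using gt le that by (meson less_le_trans)
  show "continuous_on {0..t} (\<lambda>t. ln (1 - 1 / z t) - ln (1 - 1 / y t))"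
    by (rule continuous_on_subset[where s = "{0..}"])
      (auto intro!: continuous_intros continuous_on_log_coord[OF y] continuous_on_log_coord[OF z] gt gt')
  fix r assume r: "0 < r" "r < t"
  then have "0 \<le> r" by simp
  note gt[OF this] gt'[OF this] le[OF this] c(2)[OF this]
  note * = this
  have pos: "0 < 1 - 1 / y r" "0 < 1 - 1 / z r"
    using * by (auto simp: field_simps)
  have "ln (1 - 1 / z r) - ln (1 - 1 / y r) \<le> ((1 - 1 / z r) - (1 - 1 / y r)) / (1 - 1 / y r)"
    using pos by (intro ln_diff_le)
  also have "\<dots> = (z r - y r) / (z r * (y r - 1))"
    using * by (simp add: divide_simps) (simp add: algebra_simps)
  also have "\<dots> \<le> (z r - y r) / (y r - 1)"
    using * by (intro divide_left_mono) auto
  finally have "(y r - 1) * (ln (1 - 1 / z r) - ln (1 - 1 / y r)) \<le> z r - y r"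
    using * by (simp add: field_simps)
  moreover have "1 - 1 / y r \<le> 1 - 1 / z r"
    using * by (simp add: frac_le)
  then have "0 \<le> ln (1 - 1 / z r) - ln (1 - 1 / y r)"
    using pos by simp
  then have "c * (ln (1 - 1 / z r) - ln (1 - 1 / y r))
     \<le> (y r - 1) * (ln (1 - 1 / z r) - ln (1 - 1 / y r))"
    using * by (intro mult_right_mono) auto
  ultimately have "(lam r - z r) - (lam r - y r) \<le> - c * (ln (1 - 1 / z r) - ln (1 - 1 / y r))"
    by simp
  moreover have "((\<lambda>t. ln (1 - 1 / z t) - ln (1 - 1 / y t)) has_real_derivative
      (lam r - z r) - (lam r - y r)) (at r)"
    by (intro DERIV_diff log_coord_deriv[OF y] log_coord_deriv[OF z] r *)
  ultimately show "\<exists>D. ((\<lambda>t. ln (1 - 1 / z t) - ln (1 - 1 / y t)) has_real_derivative D) (at r)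
      \<and> D \<le> - c * (ln (1 - 1 / z r) - ln (1 - 1 / y r))"
    by blast
qed fact

section \<open>Bounded convergence and integrability over a finite measure\<close>

text \<open>Norm convergence in L-infinity bounds only a tail of a sequence, so the constant has to
  dominate only eventually. The sequence is shifted past the index \<open>N\<close> before dominated
  convergence is applied.\<close>

lemma (in finite_measure) bounded_convergence_sequentially:
  fixes s :: "nat \<Rightarrow> 'a \<Rightarrow> real"
  assumes "\<And>n. s n \<in> borel_measurable M" "f \<in> borel_measurable M"
    and lim: "AE x in M. (\<lambda>n. s n x) \<longlonglongrightarrow> f x"
    and bound: "\<forall>\<^sub>F n in sequentially. AE x in M. \<bar>s n x\<bar> \<le> C"
  shows "(\<lambda>n. LINT x|M. s n x) \<longlonglongrightarrow> (LINT x|M. f x)"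
proof -
  obtain N where N: "\<And>n. N \<le> n \<Longrightarrow> AE x in M. \<bar>s n x\<bar> \<le> C"
    using bound by (auto simp: eventually_sequentially)
  show ?thesis
  proof (rule LIMSEQ_offset[of _ N], rule integral_dominated_convergence[where w = "\<lambda>_. C"])
    show "AE x in M. (\<lambda>n. s (n + N) x) \<longlonglongrightarrow> f x"
      using lim by eventually_elim (rule LIMSEQ_ignore_initial_segment)
  qed (use assms N in auto)
qed

lemma continuous_bounded_Icc:
  fixes h :: "real \<Rightarrow> real"
  assumes "continuous_on UNIV h"
  obtains C where "\<And>y. a \<le> y \<Longrightarrow> y \<le> b \<Longrightarrow> \<bar>h y\<bar> \<le> C"
proof -
  have "bounded (h ` {a..b})"
    by (intro compact_imp_bounded compact_continuous_image continuous_on_subset[OF assms]) auto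
  then obtain C where "\<forall>z\<in>h ` {a..b}. norm z \<le> C"
    unfolding bounded_iff by blast
  then show thesis
    by (intro that[of C]) auto
qed

lemma (in finite_measure) integrable_continuous_compose:
  fixes h :: "real \<Rightarrow> real"
  assumes h: "continuous_on UNIV h" and w: "w \<in> borel_measurable M"
    and range: "AE x in M. a \<le> w x \<and> w x \<le> b"
  shows "integrable M (\<lambda>x. h (w x))"
proof -
  obtain C where "\<And>y. a \<le> y \<Longrightarrow> y \<le> b \<Longrightarrow> \<bar>h y\<bar> \<le> C"
    using continuous_bounded_Icc[OF h, where a = a and b = b] by blast
  then have "AE x in M. norm (h (w x)) \<le> C"
    using range by (auto elim!: eventually_mono simp del: AE_conj_iff)
  then show ?thesis
    by (intro integrable_const_bound[where B = C] measurable_compose[OF w]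
        borel_measurable_continuous_onI h)
qed

lemma continuous_fg: "continuous_on S f_nl" "continuous_on S g_nl"
  unfolding f_nl_def g_nl_def by (intro continuous_intros)+

section \<open>The flow of the ODE for a given coefficient\<close>

locale ode_flow =
  fixes lam :: "real \<Rightarrow> real" and Y :: "real \<Rightarrow> real \<Rightarrow> real"
  assumes lam_continuous: "continuous_on {0..} lam"
    and solves: "\<And>s. solves_ODE lam s (\<lambda>t. Y t s)"
begin

lemma Y_mono: "0 \<le> t \<Longrightarrow> r \<le> s \<Longrightarrow> Y t r \<le> Y t s"
  by (rule solves_ODE_mono[OF lam_continuous solves solves])

lemma Y_one: "0 \<le> t \<Longrightarrow> Y t 1 = 1"
  by (rule solves_ODE_one[OF lam_continuous solves])

lemma Y_gt_one: "0 \<le> t \<Longrightarrow> 1 < s \<Longrightarrow> 1 < Y t s"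
  by (rule solves_ODE_gt_one[OF lam_continuous solves])

lemma Y_zero: "Y 0 s = s"
  using solves[of s] by (simp add: solves_ODE_def)

lemma Y_measurable: "0 \<le> t \<Longrightarrow> Y t \<in> borel_measurable borel"
  by (intro borel_measurable_mono monoI Y_mono)

lemma Y_continuous: "continuous_on {0..} (\<lambda>t. Y t s)"
  using solves[of s] by (simp add: solves_ODE_def)

lemma Y_deriv:
  "0 < t \<Longrightarrow> ((\<lambda>t. Y t s) has_real_derivative
     ((Y t s)\<^sup>2 * (1 - Y t s) - lam t * Y t s * (1 - Y t s))) (at t)"
  using solves[of s] by (simp add: solves_ODE_def)

lemma lam_bounded:
  obtains L where "\<And>t. 0 \<le> t \<Longrightarrow> t \<le> T \<Longrightarrow> \<bar>lam t\<bar> \<le> L"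
proof -
  have "bounded (lam ` {0..T})"
    by (intro compact_imp_bounded compact_continuous_image continuous_on_subset[OF lam_continuous]) auto
  then obtain L where "\<forall>z\<in>lam ` {0..T}. norm z \<le> L"
    unfolding bounded_iff by blast
  then show thesis
    by (intro that[of L]) auto
qed

text \<open>Monotonicity keeps all these trajectories between the equilibrium 1 and
  \<open>Y t B\<close>, and the latter is bounded on a compact time interval by continuity.\<close>

lemma Y_bounded:
  obtains K where "\<And>t s. 0 \<le> t \<Longrightarrow> t \<le> T \<Longrightarrow> 1 \<le> s \<Longrightarrow> s \<le> B \<Longrightarrow> 1 \<le> Y t s \<and> Y t s \<le> K"
proof -
  have "bounded ((\<lambda>t. Y t B) ` {0..T})"
    by (intro compact_imp_bounded compact_continuous_image continuous_on_subset[OF Y_continuous]) auto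
  then obtain K where K: "\<forall>z\<in>(\<lambda>t. Y t B) ` {0..T}. norm z \<le> K"
    unfolding bounded_iff by blast
  show thesis
  proof (rule that)
    fix t s :: real assume "0 \<le> t" "t \<le> T" "1 \<le> s" "s \<le> B"
    then show "1 \<le> Y t s \<and> Y t s \<le> K"
      using bspec[OF K, of "Y t B"] Y_mono[of t 1 s] Y_mono[of t s B] Y_one[of t] by auto
  qed
qed

text \<open>The right-hand side factors as \<open>Y * (1 - Y) * (Y - lam)\<close> and is bounded on
  \<open>{a..T}\<close> uniformly in \<open>s\<close>; the mean value inequality does the rest. The
  interval stays away from 0 because the ODE is imposed only for \<open>t > 0\<close>. The
  uniformity supplies the dominating constant for difference quotients in
  \<open>eq_flow\<close>.\<close>

lemma Y_lipschitz:
  assumes "0 < a"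
  obtains C where "\<And>t r s. t \<in> {a..T} \<Longrightarrow> r \<in> {a..T} \<Longrightarrow> s \<in> {1..B} \<Longrightarrow>
    \<bar>Y t s - Y r s\<bar> \<le> C * \<bar>t - r\<bar>"
proof -
  obtain L where L: "\<And>t. 0 \<le> t \<Longrightarrow> t \<le> T \<Longrightarrow> \<bar>lam t\<bar> \<le> L"
    using lam_bounded by blast
  obtain K where K: "\<And>t s. 0 \<le> t \<Longrightarrow> t \<le> T \<Longrightarrow> 1 \<le> s \<Longrightarrow> s \<le> B \<Longrightarrow> 1 \<le> Y t s \<and> Y t s \<le> K"
    using Y_bounded by blast
  show thesis
  proof (rule that)
    fix t r s assume tr: "t \<in> {a..T}" "r \<in> {a..T}" and s: "s \<in> {1..B}"
    have "norm (Y t s - Y r s) \<le> (K * K * (K + L)) * norm (t - r)"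
    proof (rule field_differentiable_bound[where S = "{a..T}" and f = "\<lambda>t. Y t s"])
      fix z assume z: "z \<in> {a..T}"
      with \<open>0 < a\<close> have "0 < z" "z \<le> T" by auto
      show "((\<lambda>t. Y t s) has_real_derivative
          (Y z s)\<^sup>2 * (1 - Y z s) - lam z * Y z s * (1 - Y z s)) (at z within {a..T})"
        by (rule has_field_derivative_at_within[OF Y_deriv[OF \<open>0 < z\<close>]])
      have Yz: "1 \<le> Y z s" "Y z s \<le> K"
        using K[of z s] \<open>0 < z\<close> \<open>z \<le> T\<close> s by auto
      have "\<bar>Y z s * (1 - Y z s) * (Y z s - lam z)\<bar> = Y z s * (Y z s - 1) * \<bar>Y z s - lam z\<bar>"
        using Yz by (simp add: abs_mult)
      also have "\<dots> \<le> K * K * (K + L)"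
        using Yz L[of z] \<open>0 < z\<close> \<open>z \<le> T\<close> by (intro mult_mono) auto
      finally show "norm ((Y z s)\<^sup>2 * (1 - Y z s) - lam z * Y z s * (1 - Y z s)) \<le> K * K * (K + L)"
        by (simp add: power2_eq_square algebra_simps)
    qed (use tr in auto)
    then show "\<bar>Y t s - Y r s\<bar> \<le> (K * K * (K + L)) * \<bar>t - r\<bar>"
      by simp
  qed
qed

end

section \<open>Mass-preserving flows: bounds and merging of trajectories\<close>

text \<open>The problem restated through \<open>Y\<close> alone, with \<open>Y t (u0 x)\<close> in
  place of \<open>u t x\<close>. \<open>B\<close> is an arbitrary upper bound and not the essential
  supremum, so it can later be enlarged to cover single values of \<open>u0\<close>.\<close>

locale mass_preserving_flow = finite_measure M + ode_flow lam Y
  for M :: "'a measure" and lam :: "real \<Rightarrow> real" and Y :: "real \<Rightarrow> real \<Rightarrow> real" +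
  fixes u0 :: "'a \<Rightarrow> real" and B :: real
  assumes u0_measurable [measurable]: "u0 \<in> borel_measurable M"
    and B_gt_one: "1 < B"
    and u0_range: "AE x in M. 1 \<le> u0 x \<and> u0 x \<le> B"
    and u0_nontrivial: "\<not> (AE x in M. u0 x = 1)"
    and mass: "\<And>t. 0 \<le> t \<Longrightarrow> (LINT x|M. Y t (u0 x)) = (LINT x|M. u0 x)"
    and g_nonzero: "\<And>t. 0 \<le> t \<Longrightarrow> (LINT x|M. g_nl (Y t (u0 x))) \<noteq> 0"
    and lam_eq: "\<And>t. 0 \<le> t \<Longrightarrow>
      lam t = (LINT x|M. f_nl (Y t (u0 x))) / (LINT x|M. g_nl (Y t (u0 x)))"
begin

lemma Y_u0_measurable: "0 \<le> t \<Longrightarrow> (\<lambda>x. Y t (u0 x)) \<in> borel_measurable M"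
  by (rule measurable_compose[OF u0_measurable Y_measurable])

lemma Y_range:
  assumes "0 \<le> t"
  shows "AE x in M. 1 \<le> Y t (u0 x) \<and> Y t (u0 x) \<le> Y t B"
  using u0_range by eventually_elim (metis Y_mono Y_one assms)

lemma integrable_u0: "integrable M u0"
  using integrable_continuous_compose[OF continuous_on_id u0_measurable u0_range] by simp

lemma integrable_compose_Y:
  "continuous_on UNIV h \<Longrightarrow> 0 \<le> t \<Longrightarrow> integrable M (\<lambda>x. h (Y t (u0 x)))" for h :: "real \<Rightarrow> real"
  by (rule integrable_continuous_compose[OF _ Y_u0_measurable Y_range])

lemma integrable_Y: "0 \<le> t \<Longrightarrow> integrable M (\<lambda>x. Y t (u0 x))"
  using integrable_compose_Y[OF continuous_on_id] by simp

text \<open>\<open>lam\<close> is an average of the values of \<open>Y t \<circ> u0\<close> with weights \<open>- g_nl (Y t (u0 x)) \<ge> 0\<close>.\<close>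

lemma lam_le:
  assumes "0 \<le> t"
  shows "lam t \<le> Y t B"
proof -
  have "AE x in M. Y t B * g_nl (Y t (u0 x)) \<le> f_nl (Y t (u0 x))"
    using Y_range[OF assms]
  proof eventually_elim
    case (elim x)
    then have "0 \<le> (Y t B - Y t (u0 x)) * (Y t (u0 x) * (Y t (u0 x) - 1))"
      by (intro mult_nonneg_nonneg) auto
    then show ?case
      by (simp add: f_nl_def g_nl_def power2_eq_square algebra_simps)
  qed
  then have "(LINT x|M. Y t B * g_nl (Y t (u0 x))) \<le> (LINT x|M. f_nl (Y t (u0 x)))"
    by (intro integral_mono_AE integrable_mult_right integrable_compose_Y continuous_fg assms)
  moreover have "(LINT x|M. g_nl (Y t (u0 x))) \<le> (LINT x|M. 0)"
    using Y_range[OF assms]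
    by (intro integral_mono_AE integrable_compose_Y continuous_fg assms)
      (auto simp: g_nl_def mult_nonneg_nonpos elim!: eventually_mono)
  \<comment> \<open>The integral of \<open>g_nl\<close> is nonpositive and nonzero, hence negative,
    so dividing by it reverses the inequality.\<close>
  ultimately show ?thesis
    using g_nonzero[OF assms] by (simp add: lam_eq[OF assms] neg_divide_le_eq)
qed

text \<open>Since \<open>lam t \<le> Y t B\<close>, the right-hand side
  \<open>Y * (1 - Y) * (Y - lam)\<close> is nonpositive along the top trajectory, and Gronwall
  applies with \<open>K = 0\<close>.\<close>

lemma Y_B_le:
  assumes "0 \<le> t"
  shows "Y t B \<le> B"
proof -
  have "Y t B \<le> Y 0 B * exp (0 * t)"
  proof (rule gronwall)
    show "continuous_on {0..t} (\<lambda>t. Y t B)"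
      using solves[of B] by (auto simp: solves_ODE_def elim: continuous_on_subset)
    fix r assume "0 < r" "r < t"
    then have "((\<lambda>t. Y t B) has_real_derivative
        ((Y r B)\<^sup>2 * (1 - Y r B) - lam r * Y r B * (1 - Y r B))) (at r)"
      using solves[of B] by (auto simp: solves_ODE_def)
    moreover have "0 \<le> (Y r B - lam r) * (Y r B * (Y r B - 1))"
      using lam_le[of r] Y_gt_one[of r B] B_gt_one \<open>0 < r\<close> by simp
    then have "(Y r B)\<^sup>2 * (1 - Y r B) - lam r * Y r B * (1 - Y r B) \<le> 0 * Y r B"
      by (simp add: power2_eq_square algebra_simps)
    ultimately show "\<exists>D. ((\<lambda>t. Y t B) has_real_derivative D) (at r) \<and> D \<le> 0 * Y r B"
      by blast
  qed fact
  then show ?thesis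
    by (simp add: Y_zero)
qed

definition mean :: real where "mean = (LINT x|M. u0 x) / measure M (space M)"

lemma measure_space_pos: "0 < measure M (space M)"
proof (rule ccontr)
  assume "\<not> 0 < measure M (space M)"
  then have "emeasure M (space M) = 0"
    using measure_nonneg[of M "space M"] by (simp add: emeasure_eq_measure)
  then have "AE x in M. u0 x = 1"
    by (intro AE_I[where N = "space M"]) auto
  with u0_nontrivial show False by simp
qed

text \<open>The function \<open>u0 - 1\<close> is nonnegative and not a.e. zero, so its integral is
  positive. This strict gap is the source of the lower bounds away from 1.\<close>

lemma mean_gt_one: "1 < mean"
proof -
  have "0 \<le> (LINT x|M. u0 x - 1)"
    using u0_range by (intro integral_nonneg_AE) auto
  moreover have "(LINT x|M. u0 x - 1) = 0 \<longleftrightarrow> (AE x in M. u0 x - 1 = 0)"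
    using u0_range integrable_u0 by (intro integral_nonneg_eq_0_iff_AE) auto
  then have "(LINT x|M. u0 x - 1) \<noteq> 0"
    using u0_nontrivial by simp
  ultimately have "measure M (space M) < (LINT x|M. u0 x)"
    using integrable_u0 by simp
  then show ?thesis
    using measure_space_pos by (simp add: mean_def)
qed

text \<open>Almost all values \<open>Y t (u0 x)\<close> lie below \<open>Y t B\<close>, so the
  conserved mass is at most \<open>Y t B\<close> times the total measure.\<close>

lemma mean_le_Y_B:
  assumes "0 \<le> t"
  shows "mean \<le> Y t B"
proof -
  have "(LINT x|M. Y t (u0 x)) \<le> (LINT x|M. Y t B)"
    using Y_range[OF assms] by (intro integral_mono_AE integrable_Y assms) auto
  then show ?thesis
    using measure_space_pos by (simp add: mass[OF assms] mean_def field_simps)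
qed

text \<open>The top trajectory stays above \<open>mean > 1\<close>, and its logarithmic distance to
  \<open>Y t s\<close> does not grow, so \<open>Y t s\<close> cannot approach 1.\<close>

lemma Y_ge_one_plus:
  assumes s: "1 < s" "s \<le> B"
  obtains c where "0 < c" "\<And>t. 0 \<le> t \<Longrightarrow> 1 + c \<le> Y t s"
proof
  define H where "H = ln (1 - 1 / B) - ln (1 - 1 / s)"
  \<comment> \<open>\<open>H\<close> is the logarithmic distance at time 0. Exponentiating
    \<open>ln (1 - 1 / Y t s) \<ge> ln (1 - 1 / mean) - H\<close> produces this constant.\<close>
  show "0 < (1 - 1 / mean) * exp (- H)"
    using mean_gt_one by simp
  fix t :: real assume t: "0 \<le> t"
  have gt: "1 < Y t s" "1 < Y t B"
    using Y_gt_one t s by auto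
  have pos: "0 < 1 - 1 / Y t s" "0 < 1 - 1 / Y t B"
    using gt by (auto simp: field_simps)
  have "ln (1 - 1 / Y t B) - ln (1 - 1 / Y t s)
      \<le> (ln (1 - 1 / Y 0 B) - ln (1 - 1 / Y 0 s)) * exp (- 0 * t)"
    using s Y_gt_one Y_mono by (intro log_ratio_decreasing[OF solves solves t]) (auto simp: less_imp_le)
  then have "ln (1 - 1 / Y t B) - H \<le> ln (1 - 1 / Y t s)"
    by (simp add: H_def Y_zero)
  then have "exp (ln (1 - 1 / Y t B) - H) \<le> 1 - 1 / Y t s"
    using pos by (metis exp_le_cancel_iff exp_ln)
  then have "(1 - 1 / Y t B) * exp (- H) \<le> 1 - 1 / Y t s"
    using pos by (simp add: exp_diff exp_minus field_simps)
  moreover have "(1 - 1 / mean) * exp (- H) \<le> (1 - 1 / Y t B) * exp (- H)"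
    using mean_le_Y_B[OF t] mean_gt_one by (intro mult_right_mono) (auto simp: frac_le)
  moreover have "1 - 1 / Y t s \<le> Y t s - 1"
  proof -
    have "0 \<le> (Y t s - 1)\<^sup>2 / Y t s"
      using gt by simp
    also have "\<dots> = (Y t s - 1) - (1 - 1 / Y t s)"
      using gt by (simp add: field_simps power2_eq_square)
    finally show ?thesis by simp
  qed
  ultimately show "1 + (1 - 1 / mean) * exp (- H) \<le> Y t s"
    by linarith
qed

text \<open>With a positive \<open>c\<close> the logarithmic distance decays like
  \<open>exp (- c * t)\<close>. As both trajectories stay in \<open>{1..B}\<close>, it controls the
  ordinary distance up to the factor \<open>B * B\<close>.\<close>

lemma trajectories_merge:
  assumes s: "1 < s" "s \<le> B"
  shows "((\<lambda>t. Y t B - Y t s) \<longlongrightarrow> 0) at_top"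
proof -
  obtain c where c: "0 < c" "\<And>t. 0 \<le> t \<Longrightarrow> 1 + c \<le> Y t s"
    using Y_ge_one_plus[OF s] by blast
  define H where "H = ln (1 - 1 / B) - ln (1 - 1 / s)"
  have "Y t B - Y t s \<le> B\<^sup>2 * (H * exp (- c * t))" if t: "0 \<le> t" for t
  proof -
    have gt: "1 < Y t s" "1 < Y t B" and le: "Y t s \<le> Y t B"
      using Y_gt_one Y_mono t s by auto
    have pos: "0 < 1 - 1 / Y t s" "0 < 1 - 1 / Y t B"
      using gt by (auto simp: field_simps)
    have "Y t B * Y t s \<le> B * B"
      using Y_B_le[OF t] gt le by (intro mult_mono) auto
    then have "(Y t B - Y t s) * (Y t B * Y t s) \<le> (Y t B - Y t s) * B\<^sup>2"
      using le by (intro mult_left_mono) (auto simp: power2_eq_square)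
    then have "Y t B - Y t s \<le> B\<^sup>2 * ((Y t B - Y t s) / (Y t B * Y t s))"
      using gt by (simp add: field_simps)
    also have "(Y t B - Y t s) / (Y t B * Y t s) = (1 - 1 / Y t B) - (1 - 1 / Y t s)"
      using gt by (simp add: field_simps)
    \<comment> \<open>Dividing a nonnegative number by \<open>1 - 1 / Y t B\<close>, which lies
      between 0 and 1, only enlarges it. In this form \<open>ln_diff_le\<close> bounds it by the
      difference of logarithms.\<close>
    also have "\<dots> \<le> ((1 - 1 / Y t B) - (1 - 1 / Y t s)) / (1 - 1 / Y t B)"
    proof -
      have "1 / Y t B \<le> 1 / Y t s"
        using le gt by (simp add: frac_le)
      then show ?thesis
        using pos gt by (simp add: le_divide_eq mult_left_le)
    qed
    also have "\<dots> \<le> ln (1 - 1 / Y t B) - ln (1 - 1 / Y t s)"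
      using ln_diff_le[OF pos] by (simp add: diff_divide_distrib)
    also have "\<dots> \<le> (ln (1 - 1 / Y 0 B) - ln (1 - 1 / Y 0 s)) * exp (- c * t)"
      using s Y_gt_one Y_mono c by (intro log_ratio_decreasing[OF solves solves t]) auto
    also have "ln (1 - 1 / Y 0 B) - ln (1 - 1 / Y 0 s) = H"
      by (simp add: H_def Y_zero)
    finally show ?thesis by (simp add: mult_left_mono)
  qed
  then have up: "\<forall>\<^sub>F t in at_top. Y t B - Y t s \<le> B\<^sup>2 * (H * exp (- c * t))"
    by (auto simp: eventually_at_top_linorder)
  have low: "\<forall>\<^sub>F t in at_top. 0 \<le> Y t B - Y t s"
    using Y_mono s by (auto simp: eventually_at_top_linorder)
  have "((\<lambda>t. exp (- c * t)) \<longlongrightarrow> 0) at_top"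
    using c(1) by real_asymp
  then have "((\<lambda>t. B\<^sup>2 * (H * exp (- c * t))) \<longlongrightarrow> 0) at_top"
    by (auto intro!: tendsto_mult_right_zero)
  with low up show ?thesis
    by (rule tendsto_sandwich[OF _ _ tendsto_const])
qed

section \<open>The common limit and convergence of integrals along the flow\<close>

definition ones :: "'a set" where "ones = {x \<in> space M. u0 x = 1}"
definition above :: "'a set" where "above = {x \<in> space M. 1 < u0 x}"
text \<open>The number for which the profile equal to 1 on \<open>ones\<close> and to this number on
  \<open>above\<close> has the mass of \<open>u0\<close>.\<close>

definition limit :: real where "limit = ((LINT x|M. u0 x) - measure M ones) / measure M above"

lemma sets_ones_above [measurable]: "ones \<in> sets M" "above \<in> sets M"
  by (simp_all add: ones_def above_def)

lemma measure_above_pos: "0 < measure M above"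
proof (rule ccontr)
  assume "\<not> 0 < measure M above"
  then have "above \<in> null_sets M"
    using measure_nonneg[of M above] by (intro null_setsI) (auto simp: emeasure_eq_measure)
  then have "AE x in M. x \<notin> above"
    by (rule AE_not_in)
  with u0_range have "AE x in M. u0 x = 1"
    by (auto simp: above_def)
  with u0_nontrivial show False by simp
qed

lemma AE_ones_above: "AE x in M. (x \<in> ones \<and> x \<notin> above \<and> u0 x = 1) \<or>
    (x \<notin> ones \<and> x \<in> above \<and> 1 < u0 x \<and> u0 x \<le> B)"
  using u0_range by (auto simp: ones_def above_def)

text \<open>Merging makes \<open>Y t (u0 x)\<close> asymptotic to a function with values 1 and
  \<open>Y t B\<close> only. The mass of the flow is constant, which leaves \<open>Y t B\<close> no
  other limit.\<close>

lemma Y_B_tendsto_limit: "((\<lambda>t. Y t B) \<longlongrightarrow> limit) at_top"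
proof -
  define d where "d \<equiv> \<lambda>t x. Y t (u0 x) - (indicator ones x + Y t B * indicator above x)"
  \<comment> \<open>Dominated convergence at infinity asks for measurability at every real time,
    while the flow is controlled only for \<open>t \<ge> 0\<close>; hence
    \<open>max 0 t\<close>.\<close>
  have "((\<lambda>t. LINT x|M. d (max 0 t) x) \<longlongrightarrow> (LINT x|M. 0)) at_top"
  proof (rule integral_dominated_convergence_at_top[where w = "\<lambda>_. B"])
    show "d (max 0 t) \<in> borel_measurable M" for t
      unfolding d_def using Y_u0_measurable[of "max 0 t"] by auto
    show "\<forall>\<^sub>F t in at_top. AE x in M. norm (d (max 0 t) x) \<le> B"
    proof (rule always_eventually, rule allI)
      fix t :: real
      define r where "r = max 0 t"
      then have r: "0 \<le> r" by simp
      show "AE x in M. norm (d (max 0 t) x) \<le> B"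
        using AE_ones_above
      proof eventually_elim
        case (elim x)
        then show ?case
          using Y_one[OF r] Y_B_le[OF r] Y_mono[OF r, of "u0 x" B] Y_gt_one[OF r, of "u0 x"] B_gt_one
          unfolding r_def[symmetric] by (auto simp: d_def)
      qed
    qed
    show "AE x in M. ((\<lambda>t. d (max 0 t) x) \<longlongrightarrow> 0) at_top"
      using AE_ones_above
    proof eventually_elim
      case (elim x)
      then have "((\<lambda>t. d t x) \<longlongrightarrow> 0) at_top"
      proof
        assume "x \<in> ones \<and> x \<notin> above \<and> u0 x = 1"
        then have "\<forall>\<^sub>F t in at_top. d t x = 0"
          using Y_one by (auto simp: eventually_at_top_linorder d_def)
        then show ?thesis by (rule tendsto_eventually)
      next
        assume "x \<notin> ones \<and> x \<in> above \<and> 1 < u0 x \<and> u0 x \<le> B"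
        then show ?thesis
          using tendsto_minus[OF trajectories_merge[of "u0 x"]] by (simp add: d_def)
      qed
      then show ?case
        by (rule Lim_transform_eventually) (auto simp: eventually_at_top_linorder intro!: exI[of _ 0])
    qed
  qed auto
  moreover have "(LINT x|M. d t x) = (LINT x|M. u0 x) - (measure M ones + Y t B * measure M above)"
    if "0 \<le> t" for t
    using that by (simp add: d_def integrable_Y mass less_top[symmetric])
  then have "\<forall>\<^sub>F t in at_top. (LINT x|M. d (max 0 t) x)
      = (LINT x|M. u0 x) - (measure M ones + Y t B * measure M above)"
    by (auto simp: eventually_at_top_linorder intro!: exI[of _ 0])
  ultimately have "((\<lambda>t. (LINT x|M. u0 x) - (measure M ones + Y t B * measure M above)) \<longlongrightarrow> 0) at_top"
    by (simp add: Lim_transform_eventually)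
  \<comment> \<open>The mass identity solved for \<open>Y t B\<close>: the quotient on the left
    simplifies to it.\<close>
  then have "((\<lambda>t. ((LINT x|M. u0 x) - measure M ones
      - ((LINT x|M. u0 x) - (measure M ones + Y t B * measure M above))) / measure M above)
      \<longlongrightarrow> ((LINT x|M. u0 x) - measure M ones - 0) / measure M above) at_top"
    using measure_above_pos by (intro tendsto_intros) auto
  then show ?thesis
    using measure_above_pos by (simp add: limit_def)
qed

lemma Y_tendsto_limit:
  assumes "1 < s" "s \<le> B"
  shows "((\<lambda>t. Y t s) \<longlongrightarrow> limit) at_top"
  using tendsto_diff[OF Y_B_tendsto_limit trajectories_merge[OF assms]] by simp

lemma limit_gt_one: "1 < limit"
proof -
  have "mean \<le> limit"
    using mean_le_Y_B by (intro tendsto_lowerbound[OF Y_B_tendsto_limit])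
      (auto simp: eventually_at_top_linorder)
  with mean_gt_one show ?thesis by simp
qed

lemma AE_Y_tendsto:
  "AE x in M. ((\<lambda>t. Y t (u0 x)) \<longlongrightarrow> indicator ones x + limit * indicator above x) at_top"
  using AE_ones_above
proof eventually_elim
  case (elim x)
  have "((\<lambda>t. Y t 1) \<longlongrightarrow> 1) at_top"
    using Y_one by (intro tendsto_eventually) (auto simp: eventually_at_top_linorder)
  with elim Y_tendsto_limit show ?case
    by auto
qed

text \<open>The integrand may depend on \<open>x\<close>, so that one statement serves both the
  integrals defining \<open>lam\<close> and the L1 distance to the profile. The bound is asked on
  \<open>{1..B}\<close>, where the flow stays a.e.\<close>

lemma integral_Y_tendsto:
  fixes h :: "real \<Rightarrow> 'a \<Rightarrow> real"
  assumes cont: "\<And>x. continuous_on UNIV (\<lambda>y. h y x)"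
    and meas: "\<And>f. f \<in> borel_measurable M \<Longrightarrow> (\<lambda>x. h (f x) x) \<in> borel_measurable M"
    and bound: "AE x in M. \<forall>y. 1 \<le> y \<longrightarrow> y \<le> B \<longrightarrow> \<bar>h y x\<bar> \<le> C"
  shows "((\<lambda>t. LINT x|M. h (Y t (u0 x)) x) \<longlongrightarrow>
    (LINT x|M. h (indicator ones x + limit * indicator above x) x)) at_top"
proof -
  have "((\<lambda>t. LINT x|M. h (Y (max 0 t) (u0 x)) x) \<longlongrightarrow>
    (LINT x|M. h (indicator ones x + limit * indicator above x) x)) at_top"
  proof (rule integral_dominated_convergence_at_top[where w = "\<lambda>_. C"])
    show "AE x in M. ((\<lambda>t. h (Y (max 0 t) (u0 x)) x) \<longlongrightarrow>
        h (indicator ones x + limit * indicator above x) x) at_top"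
      using AE_Y_tendsto
    proof eventually_elim
      case (elim x)
      have "((\<lambda>t. h (Y t (u0 x)) x) \<longlongrightarrow> h (indicator ones x + limit * indicator above x) x) at_top"
        by (rule continuous_on_tendsto_compose[OF cont elim]) auto
      then show ?case
        by (rule Lim_transform_eventually) (auto simp: eventually_at_top_linorder intro!: exI[of _ 0])
    qed
    show "\<forall>\<^sub>F t in at_top. AE x in M. norm (h (Y (max 0 t) (u0 x)) x) \<le> C"
    proof (rule always_eventually, rule allI)
      fix t :: real
      show "AE x in M. norm (h (Y (max 0 t) (u0 x)) x) \<le> C"
        using bound Y_range[of "max 0 t"] Y_B_le[of "max 0 t"] by (auto intro: order_trans elim!: eventually_elim2)
    qed
  qed (auto intro!: meas Y_u0_measurable)
  then show ?thesis
    by (rule Lim_transform_eventually) (auto simp: eventually_at_top_linorder intro!: exI[of _ 0])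
qed

text \<open>As \<open>h\<close> vanishes at the equilibrium 1, the set \<open>ones\<close>
  contributes nothing.\<close>

lemma integral_Y_tendsto_above:
  fixes h :: "real \<Rightarrow> real"
  assumes h: "continuous_on UNIV h" "h 1 = 0"
  shows "((\<lambda>t. LINT x|M. h (Y t (u0 x))) \<longlongrightarrow> h limit * measure M above) at_top"
proof -
  note [measurable] = borel_measurable_continuous_onI[OF h(1)]
  obtain C where "\<And>y. 1 \<le> y \<Longrightarrow> y \<le> B \<Longrightarrow> \<bar>h y\<bar> \<le> C"
    using continuous_bounded_Icc[OF h(1), where a = 1 and b = B] by blast
  then have "((\<lambda>t. LINT x|M. h (Y t (u0 x))) \<longlongrightarrow>
      (LINT x|M. h (indicator ones x + limit * indicator above x))) at_top"
    by (intro integral_Y_tendsto[where h = "\<lambda>y _. h y" and C = C] h) auto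
  also have "(LINT x|M. h (indicator ones x + limit * indicator above x))
      = (LINT x|M. h limit * indicator above x)"
    using AE_ones_above h(2) by (intro integral_cong_AE) (auto elim!: eventually_mono)
  finally show ?thesis by simp
qed

text \<open>Both integrals concentrate on \<open>above\<close>, and
  \<open>f_nl z / g_nl z = z\<close> off the zeros of \<open>g_nl\<close>; \<open>limit > 1\<close>
  keeps the limiting denominator nonzero.\<close>

lemma lam_tendsto_limit: "(lam \<longlongrightarrow> limit) at_top"
proof -
  have nz: "g_nl limit * measure M above \<noteq> 0"
    using limit_gt_one measure_above_pos by (simp add: g_nl_def)
  have "((\<lambda>t. (LINT x|M. f_nl (Y t (u0 x))) / (LINT x|M. g_nl (Y t (u0 x)))) \<longlongrightarrow>
      f_nl limit * measure M above / (g_nl limit * measure M above)) at_top"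
    using nz by (intro tendsto_divide integral_Y_tendsto_above continuous_fg) (auto simp: f_nl_def g_nl_def)
  moreover have "f_nl limit * measure M above / (g_nl limit * measure M above) = limit"
    using nz by (simp add: f_nl_def g_nl_def power2_eq_square)
  ultimately have "((\<lambda>t. (LINT x|M. f_nl (Y t (u0 x))) / (LINT x|M. g_nl (Y t (u0 x)))) \<longlongrightarrow> limit) at_top"
    by simp
  then show ?thesis
    by (rule Lim_transform_eventually) (auto simp: eventually_at_top_linorder lam_eq intro!: exI[of _ 0])
qed

lemma L1_distance_tendsto:
  "((\<lambda>t. LINT x|M. \<bar>Y t (u0 x) - (indicator ones x + limit * indicator above x)\<bar>) \<longlongrightarrow> 0) at_top"
proof (rule tendsto_eq_rhs)
  show "((\<lambda>t. LINT x|M. \<bar>Y t (u0 x) - (indicator ones x + limit * indicator above x)\<bar>) \<longlongrightarrow>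
     (LINT x|M. \<bar>indicator ones x + limit * indicator above x - (indicator ones x + limit * indicator above x)\<bar>)) at_top"
    by (rule integral_Y_tendsto[where C = "B + 1 + limit" and
          h = "\<lambda>y x. \<bar>y - (indicator ones x + limit * indicator above x)\<bar>"])
      (use limit_gt_one in \<open>auto simp: indicator_def intro!: continuous_intros\<close>)
qed simp

end

section \<open>L-infinity norms and differentiable curves in L-infinity\<close>

lemma Linf_norm_AE: "AE x in lebesgue_on \<Omega>. ennreal \<bar>w x\<bar> \<le> Linf_norm \<Omega> w"
  unfolding Linf_norm_def by (rule esssup_AE)

lemma Linf_measurable: "w \<in> Linf \<Omega> \<Longrightarrow> w \<in> borel_measurable (lebesgue_on \<Omega>)"
  by (simp add: Linf_def)

lemma Linf_AE_bound:
  assumes "w \<in> Linf \<Omega>"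
  obtains C where "AE x in lebesgue_on \<Omega>. \<bar>w x\<bar> \<le> C"
proof -
  have "Linf_norm \<Omega> w < top"
    using assms by (simp add: Linf_def)
  then obtain C where "Linf_norm \<Omega> w = ennreal C" "0 \<le> C"
    by (cases "Linf_norm \<Omega> w") auto
  then show thesis
    using Linf_norm_AE[of w \<Omega>] by (intro that[of C]) simp
qed

text \<open>Each norm bound holds off its own null set, and countably many such sets have a null
  union. This is why limits of \<open>u\<close> at finite times are taken along sequences
  below.\<close>

lemma Linf_norm_tendsto_AE:
  assumes "(\<lambda>n. Linf_norm \<Omega> (w n)) \<longlonglongrightarrow> 0"
  shows "AE x in lebesgue_on \<Omega>. (\<lambda>n. w n x) \<longlonglongrightarrow> 0"
proof -
  have "AE x in lebesgue_on \<Omega>. \<forall>n. ennreal \<bar>w n x\<bar> \<le> Linf_norm \<Omega> (w n)"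
    unfolding AE_all_countable using Linf_norm_AE by blast
  then show ?thesis
  proof eventually_elim
    case (elim x)
    have "(\<lambda>n. ennreal \<bar>w n x\<bar>) \<longlonglongrightarrow> ennreal 0"
      unfolding ennreal_0 by (rule tendsto_sandwich[OF _ _ tendsto_const assms]) (use elim in auto)
    then have "(\<lambda>n. \<bar>w n x\<bar>) \<longlonglongrightarrow> 0"
      by (subst (asm) tendsto_ennreal_iff) auto
    then show ?case
      by (simp add: tendsto_rabs_zero_iff)
  qed
qed

lemma Linf_norm_tendsto_bound:
  assumes "(\<lambda>n. Linf_norm \<Omega> (w n)) \<longlonglongrightarrow> 0"
  shows "\<forall>\<^sub>F n in sequentially. AE x in lebesgue_on \<Omega>. \<bar>w n x\<bar> \<le> 1"
proof -
  have "\<forall>\<^sub>F n in sequentially. Linf_norm \<Omega> (w n) < 1"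
    using order_tendstoD(2)[OF assms, of 1] by simp
  then show ?thesis
  proof eventually_elim
    case (elim n)
    from Linf_norm_AE[of "w n" \<Omega>] show ?case
    proof eventually_elim
      case (elim x)
      then have "ennreal \<bar>w n x\<bar> \<le> ennreal 1"
        using \<open>Linf_norm \<Omega> (w n) < 1\<close> by (metis ennreal_1 less_imp_le order_trans)
      then show ?case
        by (subst (asm) ennreal_le_iff) auto
    qed
  qed
qed

text \<open>Differentiability in norm is turned into the two hypotheses of bounded convergence for
  the difference quotients.\<close>

lemma C1_Linf_quotient:
  assumes C1: "C1_Linf_deriv \<Omega> u v" and "0 \<le> t" and X: "\<forall>n. X n \<in> {0..} - {t}" "X \<longlonglongrightarrow> t"
  shows "AE x in lebesgue_on \<Omega>. (\<lambda>n. (u (X n) x - u t x) / (X n - t)) \<longlonglongrightarrow> v t x"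
    and "\<exists>C. \<forall>\<^sub>F n in sequentially. AE x in lebesgue_on \<Omega>. \<bar>(u (X n) x - u t x) / (X n - t)\<bar> \<le> C"
proof -
  have v: "v t \<in> Linf \<Omega>"
    and "((\<lambda>s. Linf_norm \<Omega> (\<lambda>x. (u s x - u t x) / (s - t) - v t x)) \<longlongrightarrow> 0) (at t within {0..})"
    using C1 \<open>0 \<le> t\<close> unfolding C1_Linf_deriv_def by blast+
  then have lim: "(\<lambda>n. Linf_norm \<Omega> (\<lambda>x. (u (X n) x - u t x) / (X n - t) - v t x)) \<longlonglongrightarrow> 0"
    using X unfolding tendsto_at_iff_sequentially comp_def by blast
  show "AE x in lebesgue_on \<Omega>. (\<lambda>n. (u (X n) x - u t x) / (X n - t)) \<longlonglongrightarrow> v t x"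
    using Linf_norm_tendsto_AE[OF lim] by eventually_elim (rule LIM_zero_cancel)
  obtain C where C: "AE x in lebesgue_on \<Omega>. \<bar>v t x\<bar> \<le> C"
    using Linf_AE_bound[OF v] by blast
  \<comment> \<open>\<open>C\<close> bounds the derivative, and 1 eventually bounds the deviation of
    the quotient from it.\<close>
  have "\<forall>\<^sub>F n in sequentially. AE x in lebesgue_on \<Omega>. \<bar>(u (X n) x - u t x) / (X n - t)\<bar> \<le> C + 1"
    using Linf_norm_tendsto_bound[OF lim]
  proof eventually_elim
    case (elim n)
    with C show ?case by eventually_elim linarith
  qed
  then show "\<exists>C. \<forall>\<^sub>F n in sequentially. AE x in lebesgue_on \<Omega>. \<bar>(u (X n) x - u t x) / (X n - t)\<bar> \<le> C" ..
qed

text \<open>Continuity is read off from differentiability: \<open>u (X n)\<close> is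
  \<open>u t\<close> plus the bounded, convergent quotient times \<open>X n - t\<close>.\<close>

lemma C1_Linf_values:
  assumes C1: "C1_Linf_deriv \<Omega> u v" and "0 \<le> t" and X: "\<forall>n. X n \<in> {0..} - {t}" "X \<longlonglongrightarrow> t"
  shows "AE x in lebesgue_on \<Omega>. (\<lambda>n. u (X n) x) \<longlonglongrightarrow> u t x"
    and "\<exists>C. \<forall>\<^sub>F n in sequentially. AE x in lebesgue_on \<Omega>. \<bar>u (X n) x\<bar> \<le> C"
proof -
  note quot = C1_Linf_quotient[OF C1 \<open>0 \<le> t\<close> X]
  have eq: "u (X n) x = u t x + (u (X n) x - u t x) / (X n - t) * (X n - t)" for n x
  proof -
    have "X n - t \<noteq> 0"
      using X(1) by auto
    then show ?thesis
      by simp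
  qed
  have X0: "(\<lambda>n. X n - t) \<longlonglongrightarrow> 0"
    using X(2) by (rule LIM_zero)
  show "AE x in lebesgue_on \<Omega>. (\<lambda>n. u (X n) x) \<longlonglongrightarrow> u t x"
    using quot(1)
  proof eventually_elim
    case (elim x)
    have "(\<lambda>n. u t x + (u (X n) x - u t x) / (X n - t) * (X n - t)) \<longlonglongrightarrow> u t x + v t x * 0"
      by (intro tendsto_intros elim X0)
    then show ?case
      by (simp only: eq[symmetric]) simp
  qed
  obtain C where C: "\<forall>\<^sub>F n in sequentially. AE x in lebesgue_on \<Omega>. \<bar>(u (X n) x - u t x) / (X n - t)\<bar> \<le> C"
    using quot(2) by blast
  have "u t \<in> Linf \<Omega>"
    using C1 \<open>0 \<le> t\<close> by (simp add: C1_Linf_deriv_def)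
  then obtain D where D: "AE x in lebesgue_on \<Omega>. \<bar>u t x\<bar> \<le> D"
    using Linf_AE_bound by blast
  have "\<forall>\<^sub>F n in sequentially. \<bar>X n - t\<bar> < 1"
    using tendstoD[OF X0, of 1] by simp
  with C have "\<forall>\<^sub>F n in sequentially. AE x in lebesgue_on \<Omega>. \<bar>u (X n) x\<bar> \<le> D + C"
  proof eventually_elim
    case (elim n)
    from elim(1) D show ?case
    proof eventually_elim
      case (elim x)
      have "\<bar>(u (X n) x - u t x) / (X n - t) * (X n - t)\<bar> \<le> C * 1"
        unfolding abs_mult using elim \<open>\<bar>X n - t\<bar> < 1\<close> order_trans[OF abs_ge_zero elim(1)]
        by (intro mult_mono) auto
      with elim show ?case
        using eq[of n x] by linarith
    qed
  qed
  then show "\<exists>C. \<forall>\<^sub>F n in sequentially. AE x in lebesgue_on \<Omega>. \<bar>u (X n) x\<bar> \<le> C" ..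
qed

section \<open>The nonlocal problem: continuity of the coefficient, mass conservation,
  identification with the flow\<close>

locale nonlocal_solution =
  fixes \<Omega> :: "(real ^ 'n) set" and u0 :: "real ^ 'n \<Rightarrow> real"
    and u v :: "real \<Rightarrow> real ^ 'n \<Rightarrow> real"
  assumes lmeasurable: "\<Omega> \<in> lmeasurable"
    and C1: "C1_Linf_deriv \<Omega> u v"
    and u0_measurable: "u0 \<in> borel_measurable (lebesgue_on \<Omega>)"
    and initial: "AE x in lebesgue_on \<Omega>. u 0 x = u0 x"
    and g_nonzero: "\<And>t. 0 \<le> t \<Longrightarrow> (LINT x|lebesgue_on \<Omega>. g_nl (u t x)) \<noteq> 0"
    and equation: "\<And>t. 0 \<le> t \<Longrightarrow> AE x in lebesgue_on \<Omega>.
      v t x = f_nl (u t x) - nonlocal_lambda \<Omega> u t * g_nl (u t x)"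
begin

abbreviation "lam \<equiv> nonlocal_lambda \<Omega> u"

sublocale finite_measure "lebesgue_on \<Omega>"
  using lmeasurable by (simp add: finite_measure_lebesgue_on)

lemma u_Linf: "0 \<le> t \<Longrightarrow> u t \<in> Linf \<Omega>" and v_Linf: "0 \<le> t \<Longrightarrow> v t \<in> Linf \<Omega>"
  using C1 by (auto simp: C1_Linf_deriv_def)

lemma u_measurable: "0 \<le> t \<Longrightarrow> u t \<in> borel_measurable (lebesgue_on \<Omega>)"
  and v_measurable: "0 \<le> t \<Longrightarrow> v t \<in> borel_measurable (lebesgue_on \<Omega>)"
  using u_Linf v_Linf Linf_measurable by auto

lemma integrable_compose_u:
  fixes h :: "real \<Rightarrow> real"
  assumes "continuous_on UNIV h" "0 \<le> t"
  shows "integrable (lebesgue_on \<Omega>) (\<lambda>x. h (u t x))"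
proof -
  obtain C where "AE x in lebesgue_on \<Omega>. \<bar>u t x\<bar> \<le> C"
    using Linf_AE_bound[OF u_Linf[OF assms(2)]] by blast
  then show ?thesis
    by (intro integrable_continuous_compose[where a = "- C" and b = C] assms u_measurable)
      (auto elim!: eventually_mono simp del: AE_conj_iff)
qed

lemma integral_compose_u_continuous:
  fixes h :: "real \<Rightarrow> real"
  assumes h: "continuous_on UNIV h"
  shows "continuous_on {0..} (\<lambda>t. LINT x|lebesgue_on \<Omega>. h (u t x))"
  unfolding continuous_on_def tendsto_at_iff_sequentially comp_def
proof (intro ballI allI impI)
  fix t and X :: "nat \<Rightarrow> real"
  assume "t \<in> {0..}" and X': "\<forall>n. X n \<in> {0..} - {t}" and X: "X \<longlonglongrightarrow> t"
  then have t: "0 \<le> t" and X0: "\<And>n. 0 \<le> X n" by auto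
  note vals = C1_Linf_values[OF C1 t X' X]
  obtain C where C: "\<forall>\<^sub>F n in sequentially. AE x in lebesgue_on \<Omega>. \<bar>u (X n) x\<bar> \<le> C"
    using vals(2) by blast
  obtain D where D: "\<And>y. - C \<le> y \<Longrightarrow> y \<le> C \<Longrightarrow> \<bar>h y\<bar> \<le> D"
    using continuous_bounded_Icc[OF h, where a = "- C" and b = C] by blast
  note hm = measurable_compose[OF u_measurable borel_measurable_continuous_onI[OF h]]
  show "(\<lambda>n. LINT x|lebesgue_on \<Omega>. h (u (X n) x)) \<longlonglongrightarrow> (LINT x|lebesgue_on \<Omega>. h (u t x))"
  proof (rule bounded_convergence_sequentially[where C = D])
    show "AE x in lebesgue_on \<Omega>. (\<lambda>n. h (u (X n) x)) \<longlonglongrightarrow> h (u t x)"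
      using vals(1) by eventually_elim (rule continuous_on_tendsto_compose[OF h], auto)
    show "\<forall>\<^sub>F n in sequentially. AE x in lebesgue_on \<Omega>. \<bar>h (u (X n) x)\<bar> \<le> D"
      using C by eventually_elim (auto elim!: eventually_mono intro!: D)
  qed (use hm t X0 in auto)
qed

lemma lam_continuous: "continuous_on {0..} lam"
proof -
  have "continuous_on {0..} (\<lambda>t. (LINT x|lebesgue_on \<Omega>. f_nl (u t x)) / (LINT x|lebesgue_on \<Omega>. g_nl (u t x)))"
    using g_nonzero by (intro continuous_on_divide integral_compose_u_continuous continuous_fg) auto
  then show ?thesis
    by (simp add: nonlocal_lambda_def[abs_def])
qed

text \<open>The coefficient is exactly the ratio for which \<open>f_nl - lam * g_nl\<close>
  integrates to zero; bounded convergence justifies differentiating under the integral.\<close>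

lemma mass_conserved:
  assumes "0 \<le> t"
  shows "(LINT x|lebesgue_on \<Omega>. u t x) = (LINT x|lebesgue_on \<Omega>. u0 x)"
proof -
  have int_u: "integrable (lebesgue_on \<Omega>) (u t)" if "0 \<le> t" for t
    using integrable_compose_u[OF continuous_on_id that] by simp
  have deriv: "((\<lambda>t. LINT x|lebesgue_on \<Omega>. u t x) has_real_derivative 0) (at t within {0..})"
    if t: "t \<in> {0..}" for t
    unfolding has_field_derivative_iff tendsto_at_iff_sequentially comp_def
  proof (intro allI impI)
    fix X :: "nat \<Rightarrow> real"
    assume X': "\<forall>n. X n \<in> {0..} - {t}" and X: "X \<longlonglongrightarrow> t"
    then have t: "0 \<le> t" and X0: "\<And>n. 0 \<le> X n" using that by auto
    note quot = C1_Linf_quotient[OF C1 t X' X]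
    obtain C where C: "\<forall>\<^sub>F n in sequentially. AE x in lebesgue_on \<Omega>.
        \<bar>(u (X n) x - u t x) / (X n - t)\<bar> \<le> C"
      using quot(2) by blast
    have "(\<lambda>n. LINT x|lebesgue_on \<Omega>. (u (X n) x - u t x) / (X n - t)) \<longlonglongrightarrow> (LINT x|lebesgue_on \<Omega>. v t x)"
      by (rule bounded_convergence_sequentially[OF _ _ quot(1) C])
        (use u_measurable v_measurable t X0 in auto)
    moreover have "(LINT x|lebesgue_on \<Omega>. v t x)
        = (LINT x|lebesgue_on \<Omega>. f_nl (u t x) - lam t * g_nl (u t x))"
    proof (rule integral_cong_AE)
      show "(\<lambda>x. f_nl (u t x) - lam t * g_nl (u t x)) \<in> borel_measurable (lebesgue_on \<Omega>)"
        by (intro borel_measurable_integrable Bochner_Integration.integrable_diff integrable_mult_right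
            integrable_compose_u continuous_fg t)
    qed (use equation[OF t] v_measurable[OF t] in auto)
    then have "(LINT x|lebesgue_on \<Omega>. v t x) = 0"
      using g_nonzero[OF t] t by (simp add: integrable_compose_u continuous_fg nonlocal_lambda_def)
    ultimately show "(\<lambda>n. ((LINT x|lebesgue_on \<Omega>. u (X n) x) - (LINT x|lebesgue_on \<Omega>. u t x)) / (X n - t)) \<longlonglongrightarrow> 0"
      using int_u t X0 by simp
  qed
  obtain c where c: "\<And>t. t \<in> {0..} \<Longrightarrow> (LINT x|lebesgue_on \<Omega>. u t x) = c"
    using has_field_derivative_zero_constant[OF convex_real_interval(1) deriv] by blast
  have "(LINT x|lebesgue_on \<Omega>. u 0 x) = (LINT x|lebesgue_on \<Omega>. u0 x)"
    using initial u0_measurable u_measurable by (intro integral_cong_AE) auto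
  with c[of t] c[of 0] assms show ?thesis by simp
qed

text \<open>Gronwall for \<open>E(t) = \<integral>(u(t) - Y(t;u\<^sub>0))\<^sup>2\<close>: the difference quotient \<open>q\<close> of the cubic
  right-hand side is bounded above by \<open>1 + \<lambda> + \<lambda>\<^sup>2\<close>, independently of the size of \<open>u\<close>.\<close>

lemma eq_flow:
  assumes flow: "ode_flow lam Y" and range: "AE x in lebesgue_on \<Omega>. 1 \<le> u0 x \<and> u0 x \<le> B" and "0 \<le> T"
  shows "AE x in lebesgue_on \<Omega>. u T x = Y T (u0 x)"
proof -
  interpret ode_flow lam Y by (rule flow)
  define d where "d \<equiv> \<lambda>t x. u t x - Y t (u0 x)"
  define E where "E \<equiv> \<lambda>t. LINT x|lebesgue_on \<Omega>. (d t x)\<^sup>2"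
  have Y_measurable': "(\<lambda>x. Y t (u0 x)) \<in> borel_measurable (lebesgue_on \<Omega>)" if "0 \<le> t" for t
    by (rule measurable_compose[OF u0_measurable Y_measurable[OF that]])
  have d_measurable: "d t \<in> borel_measurable (lebesgue_on \<Omega>)" if "0 \<le> t" for t
    unfolding d_def using u_measurable[OF that] Y_measurable'[OF that] by simp
  have d_bounded: "\<exists>C. AE x in lebesgue_on \<Omega>. \<bar>d t x\<bar> \<le> C" if t: "0 \<le> t" for t
  proof -
    obtain C where C: "AE x in lebesgue_on \<Omega>. \<bar>u t x\<bar> \<le> C"
      using Linf_AE_bound[OF u_Linf[OF t]] by blast
    obtain K where K: "\<And>r s. 0 \<le> r \<Longrightarrow> r \<le> t \<Longrightarrow> 1 \<le> s \<Longrightarrow> s \<le> B \<Longrightarrow> 1 \<le> Y r s \<and> Y r s \<le> K"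
      using Y_bounded by blast
    have "AE x in lebesgue_on \<Omega>. \<bar>d t x\<bar> \<le> C + K"
      using C range
    proof eventually_elim
      case (elim x)
      with K[OF t order_refl, of "u0 x"] show ?case by (auto simp: d_def)
    qed
    then show ?thesis ..
  qed
  have d_integrable: "integrable (lebesgue_on \<Omega>) (\<lambda>x. (d t x)\<^sup>2)" if t: "0 \<le> t" for t
  proof -
    obtain C where C: "AE x in lebesgue_on \<Omega>. \<bar>d t x\<bar> \<le> C"
      using d_bounded[OF t] by blast
    have "AE x in lebesgue_on \<Omega>. norm ((d t x)\<^sup>2) \<le> C * C"
      using C
    proof eventually_elim
      case (elim x)
      then have "\<bar>d t x\<bar> * \<bar>d t x\<bar> \<le> C * C"
        by (intro mult_mono) auto
      then show ?case by (simp add: power2_eq_square)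
    qed
    then show ?thesis
      using d_measurable[OF t] by (intro integrable_const_bound) auto
  qed
  have d_limit: "AE x in lebesgue_on \<Omega>. (\<lambda>n. d (X n) x) \<longlonglongrightarrow> d t x"
    and d_limit_bound: "\<exists>C. \<forall>\<^sub>F n in sequentially. AE x in lebesgue_on \<Omega>. \<bar>d (X n) x\<bar> \<le> C"
    if t: "0 \<le> t" and X: "\<forall>n. X n \<in> {0..} - {t}" "X \<longlonglongrightarrow> t" for X t
  proof -
    note vals = C1_Linf_values[OF C1 t X]
    have X0: "\<forall>\<^sub>F n in sequentially. X n \<in> {0..}"
      using X(1) by auto
    show "AE x in lebesgue_on \<Omega>. (\<lambda>n. d (X n) x) \<longlonglongrightarrow> d t x"
      using vals(1)
    proof eventually_elim
      case (elim x)
      have "(\<lambda>n. Y (X n) (u0 x)) \<longlonglongrightarrow> Y t (u0 x)"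
        using t by (intro continuous_on_tendsto_compose[OF Y_continuous X(2) _ X0]) auto
      with elim show ?case
        unfolding d_def by (rule tendsto_diff)
    qed
    obtain C where C: "\<forall>\<^sub>F n in sequentially. AE x in lebesgue_on \<Omega>. \<bar>u (X n) x\<bar> \<le> C"
      using vals(2) by blast
    obtain K where K: "\<And>r s. 0 \<le> r \<Longrightarrow> r \<le> t + 1 \<Longrightarrow> 1 \<le> s \<Longrightarrow> s \<le> B \<Longrightarrow> 1 \<le> Y r s \<and> Y r s \<le> K"
      using Y_bounded by blast
    have "\<forall>\<^sub>F n in sequentially. X n < t + 1"
      using order_tendstoD(2)[OF X(2)] by simp
    with C X0 have "\<forall>\<^sub>F n in sequentially. AE x in lebesgue_on \<Omega>. \<bar>d (X n) x\<bar> \<le> C + K"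
    proof eventually_elim
      case (elim n)
      from elim(1) range show ?case
      proof eventually_elim
        case (elim x)
        with K[of "X n" "u0 x"] \<open>X n \<in> {0..}\<close> \<open>X n < t + 1\<close> show ?case by (auto simp: d_def)
      qed
    qed
    then show "\<exists>C. \<forall>\<^sub>F n in sequentially. AE x in lebesgue_on \<Omega>. \<bar>d (X n) x\<bar> \<le> C" ..
  qed
  have E_continuous: "continuous_on {0..} E"
    unfolding continuous_on_def tendsto_at_iff_sequentially comp_def
  proof (intro ballI allI impI)
    fix t and X :: "nat \<Rightarrow> real"
    assume "t \<in> {0..}" and X: "\<forall>n. X n \<in> {0..} - {t}" "X \<longlonglongrightarrow> t"
    then have t: "0 \<le> t" and X0: "\<And>n. 0 \<le> X n" by auto
    obtain C where C: "\<forall>\<^sub>F n in sequentially. AE x in lebesgue_on \<Omega>. \<bar>d (X n) x\<bar> \<le> C"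
      using d_limit_bound[OF t X] by blast
    show "(\<lambda>n. E (X n)) \<longlonglongrightarrow> E t"
      unfolding E_def
    proof (rule bounded_convergence_sequentially[where C = "C * C"])
      show "AE x in lebesgue_on \<Omega>. (\<lambda>n. (d (X n) x)\<^sup>2) \<longlonglongrightarrow> (d t x)\<^sup>2"
        using d_limit[OF t X] by eventually_elim (rule tendsto_power)
      show "\<forall>\<^sub>F n in sequentially. AE x in lebesgue_on \<Omega>. \<bar>(d (X n) x)\<^sup>2\<bar> \<le> C * C"
        using C
      proof eventually_elim
        case (elim n)
        then show ?case
        proof eventually_elim
          case (elim x)
          then have "\<bar>d (X n) x\<bar> * \<bar>d (X n) x\<bar> \<le> C * C"
            by (intro mult_mono) auto
          then show ?case by (simp add: power2_eq_square)
        qed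
      qed
    qed (use d_measurable t X0 in auto)
  qed
  obtain L where L: "\<And>t. 0 \<le> t \<Longrightarrow> t \<le> T \<Longrightarrow> \<bar>lam t\<bar> \<le> L"
    using lam_bounded by blast
  have E_deriv: "\<exists>D. (E has_real_derivative D) (at t) \<and> D \<le> 2 * (1 + L + L * L) * E t"
    if t: "0 < t" "t < T" for t
  proof -
    \<comment> \<open>\<open>F\<close> is the right-hand side of the ODE at time \<open>t\<close>,
      and \<open>w\<close> is the pointwise time derivative of the square of
      \<open>d\<close>.\<close>
    define F where "F \<equiv> \<lambda>y. y\<^sup>2 * (1 - y) - lam t * y * (1 - y)"
    define w where "w \<equiv> \<lambda>x. (v t x - F (Y t (u0 x))) * (2 * d t x)"
    have t0: "0 \<le> t" using t by simp
    have w_measurable: "w \<in> borel_measurable (lebesgue_on \<Omega>)"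
      unfolding w_def F_def using v_measurable[OF t0] Y_measurable'[OF t0] d_measurable[OF t0] by auto
    have "(E has_real_derivative (LINT x|lebesgue_on \<Omega>. w x)) (at t within {0..})"
      unfolding has_field_derivative_iff tendsto_at_iff_sequentially comp_def
    proof (intro allI impI)
      fix X :: "nat \<Rightarrow> real"
      assume X: "\<forall>n. X n \<in> {0..} - {t}" "X \<longlonglongrightarrow> t"
      then have X0: "\<And>n. 0 \<le> X n" and Xt: "\<And>n. X n \<noteq> t" by auto
      note quot = C1_Linf_quotient[OF C1 t0 X]
      obtain C where C: "\<forall>\<^sub>F n in sequentially. AE x in lebesgue_on \<Omega>.
          \<bar>(u (X n) x - u t x) / (X n - t)\<bar> \<le> C"
        using quot(2) by blast
      obtain K where K: "\<forall>\<^sub>F n in sequentially. AE x in lebesgue_on \<Omega>. \<bar>d (X n) x\<bar> \<le> K"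
        using d_limit_bound[OF t0 X] by blast
      obtain K' where K': "AE x in lebesgue_on \<Omega>. \<bar>d t x\<bar> \<le> K'"
        using d_bounded[OF t0] by blast
      \<comment> \<open>The points \<open>X n\<close> eventually lie in \<open>{t / 2..T}\<close>,
        where the flow is Lipschitz in time uniformly in the initial value.\<close>
      have "0 < t / 2" using t by simp
      then obtain G where G: "\<And>r r' s. r \<in> {t / 2..T} \<Longrightarrow> r' \<in> {t / 2..T} \<Longrightarrow> s \<in> {1..B} \<Longrightarrow>
          \<bar>Y r s - Y r' s\<bar> \<le> G * \<bar>r - r'\<bar>"
        using Y_lipschitz by blast
      \<comment> \<open>The quotient is split into one factor bounded by \<open>C + G\<close> and
        one bounded by \<open>K + K'\<close>.\<close>
      have eq: "((d (X n) x)\<^sup>2 - (d t x)\<^sup>2) / (X n - t) =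
          ((u (X n) x - u t x) / (X n - t) - (Y (X n) (u0 x) - Y t (u0 x)) / (X n - t)) * (d (X n) x + d t x)"
        for n x
      proof -
        have "(d (X n) x)\<^sup>2 - (d t x)\<^sup>2 =
            ((u (X n) x - u t x) - (Y (X n) (u0 x) - Y t (u0 x))) * (d (X n) x + d t x)"
          by (simp add: d_def power2_eq_square algebra_simps)
        then show ?thesis
          by (simp only: diff_divide_distrib[symmetric] times_divide_eq_left)
      qed
      have "(\<lambda>n. LINT x|lebesgue_on \<Omega>. ((d (X n) x)\<^sup>2 - (d t x)\<^sup>2) / (X n - t)) \<longlonglongrightarrow> (LINT x|lebesgue_on \<Omega>. w x)"
      proof (rule bounded_convergence_sequentially[where C = "(C + G) * (K + K')"])
        show "AE x in lebesgue_on \<Omega>. (\<lambda>n. ((d (X n) x)\<^sup>2 - (d t x)\<^sup>2) / (X n - t)) \<longlonglongrightarrow> w x"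
          using quot(1) d_limit[OF t0 X]
        proof eventually_elim
          case (elim x)
          have "((\<lambda>r. (Y r (u0 x) - Y t (u0 x)) / (r - t)) \<longlongrightarrow> F (Y t (u0 x))) (at t)"
            using Y_deriv[OF t(1), of "u0 x"] by (simp add: has_field_derivative_iff F_def)
          then have "(\<lambda>n. (Y (X n) (u0 x) - Y t (u0 x)) / (X n - t)) \<longlonglongrightarrow> F (Y t (u0 x))"
            using X(2) Xt unfolding tendsto_at_iff_sequentially comp_def by blast
          then have "(\<lambda>n. ((u (X n) x - u t x) / (X n - t) - (Y (X n) (u0 x) - Y t (u0 x)) / (X n - t))
              * (d (X n) x + d t x)) \<longlonglongrightarrow> (v t x - F (Y t (u0 x))) * (d t x + d t x)"
            by (intro tendsto_intros elim)
          then show ?case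
            by (simp only: eq w_def mult_2)
        qed
        have "\<forall>\<^sub>F n in sequentially. t / 2 < X n"
          by (rule order_tendstoD(1)[OF X(2)]) (use t in simp)
        moreover have "\<forall>\<^sub>F n in sequentially. X n < T"
          by (rule order_tendstoD(2)[OF X(2)]) (use t in simp)
        ultimately show "\<forall>\<^sub>F n in sequentially. AE x in lebesgue_on \<Omega>.
            \<bar>((d (X n) x)\<^sup>2 - (d t x)\<^sup>2) / (X n - t)\<bar> \<le> (C + G) * (K + K')"
          using C K
        proof eventually_elim
          case (elim n)
          note Xn = elim(1,2)
          from elim(3,4) K' range show ?case
          proof eventually_elim
            case (elim x)
            have "\<bar>Y (X n) (u0 x) - Y t (u0 x)\<bar> \<le> G * \<bar>X n - t\<bar>"
              using Xn t elim by (intro G) auto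
            then have "\<bar>(Y (X n) (u0 x) - Y t (u0 x)) / (X n - t)\<bar> \<le> G"
              using Xt[of n] by (simp add: abs_divide divide_le_eq)
            with elim have "\<bar>(u (X n) x - u t x) / (X n - t) - (Y (X n) (u0 x) - Y t (u0 x)) / (X n - t)\<bar> \<le> C + G"
              "\<bar>d (X n) x + d t x\<bar> \<le> K + K'"
              by linarith+
            then show ?case
              unfolding eq abs_mult by (intro mult_mono) auto
          qed
        qed
      qed (use d_measurable t0 X0 w_measurable in auto)
      then show "(\<lambda>n. (E (X n) - E t) / (X n - t)) \<longlonglongrightarrow> (LINT x|lebesgue_on \<Omega>. w x)"
        using d_integrable t0 X0 by (simp add: E_def)
    qed
    then have deriv: "(E has_real_derivative (LINT x|lebesgue_on \<Omega>. w x)) (at t)"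
      using t(1) by (subst (asm) at_within_open_subset[where S = "{0<..}"]) auto
    have w_le: "AE x in lebesgue_on \<Omega>. w x \<le> 2 * (1 + L + L * L) * (d t x)\<^sup>2"
      using equation[OF t0]
    proof eventually_elim
      case (elim x)
      define a b where "a = u t x" and "b = Y t (u0 x)"
      define q where "q = (1 + lam t) * (a + b) - lam t - (a\<^sup>2 + a * b + b\<^sup>2)"
      \<comment> \<open>Half of this sum of squares equals
        \<open>1 + lam t + lam t * lam t - q\<close>.\<close>
      have "0 \<le> (a + b)\<^sup>2 + (a - (1 + lam t))\<^sup>2 + (b - (1 + lam t))\<^sup>2"
        by simp
      then have "q \<le> 1 + lam t + lam t * lam t"
        by (simp add: q_def power2_eq_square algebra_simps)
      moreover have lam_t: "\<bar>lam t\<bar> \<le> L"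
        using L[of t] t by simp
      then have "\<bar>lam t\<bar> * \<bar>lam t\<bar> \<le> L * L"
        using abs_ge_zero[of "lam t"] by (intro mult_mono) linarith+
      then have "lam t * lam t \<le> L * L"
        by simp
      ultimately have "q \<le> 1 + L + L * L"
        using lam_t by linarith
      then have "q * (2 * (a - b)\<^sup>2) \<le> (1 + L + L * L) * (2 * (a - b)\<^sup>2)"
        by (intro mult_right_mono) auto
      moreover have "(a\<^sup>2 * (1 - a) - lam t * (a * (1 - a))) - (b\<^sup>2 * (1 - b) - lam t * b * (1 - b)) = q * (a - b)"
        unfolding q_def by algebra
      then have "w x = q * (2 * (a - b)\<^sup>2)"
        unfolding w_def F_def d_def elim f_nl_def g_nl_def a_def[symmetric] b_def[symmetric]
        by (simp add: power2_eq_square)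
      ultimately have "w x \<le> (1 + L + L * L) * (2 * (a - b)\<^sup>2)"
        by simp
      also have "\<dots> = 2 * (1 + L + L * L) * (d t x)\<^sup>2"
        by (simp add: d_def a_def b_def algebra_simps)
      finally show ?case .
    qed
    have "(LINT x|lebesgue_on \<Omega>. w x) \<le> (LINT x|lebesgue_on \<Omega>. 2 * (1 + L + L * L) * (d t x)\<^sup>2)"
    proof (rule integral_mono_AE[OF _ _ w_le])
      obtain C where C: "AE x in lebesgue_on \<Omega>. \<bar>d t x\<bar> \<le> C"
        using d_bounded[OF t0] by blast
      obtain V where V: "AE x in lebesgue_on \<Omega>. \<bar>v t x\<bar> \<le> V"
        using Linf_AE_bound[OF v_Linf[OF t0]] by blast
      have "continuous_on UNIV F"
        unfolding F_def by (intro continuous_intros)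
      moreover obtain K where K: "\<And>r s. 0 \<le> r \<Longrightarrow> r \<le> t \<Longrightarrow> 1 \<le> s \<Longrightarrow> s \<le> B \<Longrightarrow> 1 \<le> Y r s \<and> Y r s \<le> K"
        using Y_bounded by blast
      ultimately obtain G where G: "\<And>y. 1 \<le> y \<Longrightarrow> y \<le> K \<Longrightarrow> \<bar>F y\<bar> \<le> G"
        using continuous_bounded_Icc[where a = 1 and b = K] by blast
      have "AE x in lebesgue_on \<Omega>. norm (w x) \<le> (V + G) * (2 * C)"
        using C V range
      proof eventually_elim
        case (elim x)
        have "\<bar>F (Y t (u0 x))\<bar> \<le> G"
          using elim K[OF t0 order_refl, of "u0 x"] by (intro G) auto
        then have "\<bar>v t x - F (Y t (u0 x))\<bar> \<le> V + G" "\<bar>2 * d t x\<bar> \<le> 2 * C"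
          using elim by linarith+
        then show ?case
          unfolding w_def real_norm_def abs_mult[of "v t x - F (Y t (u0 x))"]
          by (intro mult_mono) auto
      qed
      then show "integrable (lebesgue_on \<Omega>) w"
        using w_measurable by (rule integrable_const_bound)
      show "integrable (lebesgue_on \<Omega>) (\<lambda>x. 2 * (1 + L + L * L) * (d t x)\<^sup>2)"
        using d_integrable[OF t0] by simp
    qed
    also have "\<dots> = 2 * (1 + L + L * L) * E t"
      by (simp add: E_def)
    finally show ?thesis
      using deriv by blast
  qed
  \<comment> \<open>The initial data agree, so \<open>E 0 = 0\<close> and Gronwall leaves only
    \<open>E T = 0\<close>.\<close>
  have "E T \<le> E 0 * exp (2 * (1 + L + L * L) * T)"
    using E_deriv E_continuous \<open>0 \<le> T\<close> by (intro gronwall) (auto elim: continuous_on_subset)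
  moreover have "E 0 = (LINT x|lebesgue_on \<Omega>. 0)"
    unfolding E_def using initial d_measurable[of 0]
    by (intro integral_cong_AE) (auto simp: d_def Y_zero elim!: eventually_mono)
  ultimately have "E T \<le> 0" by simp
  moreover have "0 \<le> E T"
    by (simp add: E_def)
  ultimately have "E T = 0" by simp
  then have "AE x in lebesgue_on \<Omega>. (d T x)\<^sup>2 = 0"
    unfolding E_def using integral_nonneg_eq_0_iff_AE[OF d_integrable[OF \<open>0 \<le> T\<close>]] by simp
  then show ?thesis
    by (simp add: d_def)
qed

end

section \<open>Representatives of limit points, and the asymptotics of the nonlocal problem\<close>

text \<open>By completeness of Lebesgue measure, preimages that differ by a null set are measurable
  together. The lemma serves \<open>omega_limit\<close>, which contains every representative, and
  these are given only through a.e. equality.\<close>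

lemma measurable_lebesgue_on_AE:
  fixes f g :: "'a::euclidean_space \<Rightarrow> real"
  assumes \<Omega>: "\<Omega> \<in> sets lebesgue" and f: "f \<in> borel_measurable (lebesgue_on \<Omega>)"
    and ae: "AE x in lebesgue_on \<Omega>. g x = f x"
  shows "g \<in> borel_measurable (lebesgue_on \<Omega>)"
proof -
  interpret complete_measure "lebesgue_on \<Omega>"
  proof
    fix A B :: "'a set"
    assume "B \<subseteq> A" "A \<in> null_sets (lebesgue_on \<Omega>)"
    with \<Omega> show "B \<in> sets (lebesgue_on \<Omega>)"
      by (auto simp: null_sets_restrict_space sets_restrict_space_iff intro: completion.complete)
  qed
  show ?thesis
  proof (rule measurableI)
    fix S :: "real set" assume "S \<in> sets borel"
    with f have "f -` S \<inter> space (lebesgue_on \<Omega>) \<in> sets (lebesgue_on \<Omega>)"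
      by (rule measurable_sets)
    then show "g -` S \<inter> space (lebesgue_on \<Omega>) \<in> sets (lebesgue_on \<Omega>)"
      by (rule in_sets_AE[rotated]) (use ae in \<open>auto elim!: eventually_mono\<close>)
  qed simp
qed

theorem theorem4p4:
  fixes \<Omega> :: "(real ^ 'n) set"
    and u0 :: "real ^ 'n \<Rightarrow> real"
    and u :: "real \<Rightarrow> real ^ 'n \<Rightarrow> real"
    and Y :: "real \<Rightarrow> real \<Rightarrow> real"
  assumes "open \<Omega>" and "bounded \<Omega>"
    and "u0 \<in> Linf \<Omega>"
    and "AE x in lebesgue_on \<Omega>. u0 x \<ge> 1"
    and "\<not> (AE x in lebesgue_on \<Omega>. u0 x = 1)"
    and "global_solution \<Omega> u0 u"
    and "\<And>s. solves_ODE (nonlocal_lambda \<Omega> u) s (\<lambda>t. Y t s)"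
  shows "(\<forall>x\<in>Omega_one \<Omega> u0. ((\<lambda>t. Y t (u0 x)) \<longlongrightarrow> 1) at_top) \<and>
         (\<forall>x\<in>Omega_plus \<Omega> u0. ((\<lambda>t. Y t (u0 x)) \<longlongrightarrow> lambda_infty \<Omega> u) at_top) \<and>
         (\<forall>\<phi>. \<phi> \<in> omega_limit \<Omega> u \<longleftrightarrow>
            (AE x in lebesgue_on \<Omega>.
               \<phi> x = indicat_real (Omega_one \<Omega> u0) x
                   + lambda_infty \<Omega> u * indicat_real (Omega_plus \<Omega> u0) x)) \<and>
         (\<forall>l. measure lebesgue (Omega_one \<Omega> u0) + l * measure lebesgue (Omega_plus \<Omega> u0)
                = (LINT x|lebesgue_on \<Omega>. u0 x)
              \<longleftrightarrow> l = lambda_infty \<Omega> u)"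
proof -
  let ?M = "lebesgue_on \<Omega>" and ?lam = "nonlocal_lambda \<Omega> u"
  have lmeas: "\<Omega> \<in> lmeasurable"
    using assms(1,2) by (intro lmeasurable_open)
  obtain v where v: "C1_Linf_deriv \<Omega> u v"
    "\<forall>t\<ge>0. AE x in ?M. v t x = f_nl (u t x) - ?lam t * g_nl (u t x)"
    using assms(6) unfolding global_solution_def by blast
  note u0_measurable = Linf_measurable[OF assms(3)]
  interpret sol: nonlocal_solution \<Omega> u0 u v
    using lmeas v u0_measurable assms(6) by unfold_locales (auto simp: global_solution_def)
  have flow: "ode_flow ?lam Y"
    using sol.lam_continuous assms(7) by unfold_locales
  obtain B0 where B0: "AE x in ?M. \<bar>u0 x\<bar> \<le> B0"
    using Linf_AE_bound[OF assms(3)] by blast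
  have range: "AE x in ?M. 1 \<le> u0 x \<and> u0 x \<le> B" if "B0 \<le> B" for B
    using B0 assms(4) by eventually_elim (use that in auto)
  have u_eq: "AE x in ?M. u t x = Y t (u0 x)" if "0 \<le> t" for t
    by (rule sol.eq_flow[OF flow range[OF order_refl] that])
  have Y_measurable: "(\<lambda>x. Y t (u0 x)) \<in> borel_measurable ?M" if "0 \<le> t" for t
    by (rule measurable_compose[OF u0_measurable ode_flow.Y_measurable[OF flow that]])
  \<comment> \<open>This carries mass conservation and the formula for the coefficient over from
    \<open>u\<close> to \<open>Y\<close>.\<close>
  have int_eq: "(LINT x|?M. h (Y t (u0 x))) = (LINT x|?M. h (u t x))"
    if h: "continuous_on UNIV h" and t: "0 \<le> t" for h :: "real \<Rightarrow> real" and t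
  proof (rule integral_cong_AE)
    note hm = borel_measurable_continuous_onI[OF h]
    show "(\<lambda>x. h (Y t (u0 x))) \<in> borel_measurable ?M"
      by (rule measurable_compose[OF Y_measurable[OF t] hm])
    show "(\<lambda>x. h (u t x)) \<in> borel_measurable ?M"
      by (rule measurable_compose[OF sol.u_measurable[OF t] hm])
    show "AE x in ?M. h (Y t (u0 x)) = h (u t x)"
      using u_eq[OF t] by eventually_elim simp
  qed
  have preserving: "mass_preserving_flow ?M ?lam Y u0 B" if B: "1 < B" "B0 \<le> B" for B
  proof -
    interpret ode_flow ?lam Y by (rule flow)
    show ?thesis
    proof
      show "(LINT x|?M. Y t (u0 x)) = (LINT x|?M. u0 x)" if "0 \<le> t" for t
        using int_eq[OF continuous_on_id that] sol.mass_conserved[OF that] by simp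
      show "(LINT x|?M. g_nl (Y t (u0 x))) \<noteq> 0" if "0 \<le> t" for t
        using sol.g_nonzero[OF that] int_eq[OF continuous_fg(2) that] by simp
      show "?lam t = (LINT x|?M. f_nl (Y t (u0 x))) / (LINT x|?M. g_nl (Y t (u0 x)))" if "0 \<le> t" for t
        using int_eq[OF continuous_fg(1) that] int_eq[OF continuous_fg(2) that]
        by (simp add: nonlocal_lambda_def)
    qed (use u0_measurable B range assms(5) in auto)
  qed
  define B where "B = max 2 B0"
  interpret P: mass_preserving_flow ?M ?lam Y u0 B
    by (rule preserving) (auto simp: B_def)
  \<comment> \<open>\<open>Lim\<close> yields the actual limit because convergence of the
    coefficient has been established.\<close>
  have lam_inf: "lambda_infty \<Omega> u = P.limit"
    unfolding lambda_infty_def by (rule tendsto_Lim[OF _ P.lam_tendsto_limit]) simp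
  have ones: "P.ones = Omega_one \<Omega> u0" and above: "P.above = Omega_plus \<Omega> u0"
    by (auto simp: P.ones_def P.above_def Omega_one_def Omega_plus_def)
  have meas: "measure ?M (Omega_one \<Omega> u0) = measure lebesgue (Omega_one \<Omega> u0)"
    "measure ?M (Omega_plus \<Omega> u0) = measure lebesgue (Omega_plus \<Omega> u0)"
    using lmeas by (auto intro!: measure_restrict_space simp: Omega_one_def Omega_plus_def)
  define \<psi> where "\<psi> \<equiv> \<lambda>x. indicat_real (Omega_one \<Omega> u0) x
    + lambda_infty \<Omega> u * indicat_real (Omega_plus \<Omega> u0) x"
  have \<psi>_eq: "\<psi> = (\<lambda>x. indicator P.ones x + P.limit * indicator P.above x)"
    by (simp add: \<psi>_def ones above lam_inf)
  have \<psi>_integrable: "integrable ?M \<psi>"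
    unfolding \<psi>_eq using P.sets_ones_above by (simp add: less_top[symmetric])
  have u_integrable: "integrable ?M (u t)" if "0 \<le> t" for t
    using sol.integrable_compose_u[OF continuous_on_id that] by simp
  have dist: "((\<lambda>t. LINT x|?M. \<bar>u t x - \<psi> x\<bar>) \<longlongrightarrow> 0) at_top"
  proof (rule Lim_transform_eventually[OF P.L1_distance_tendsto])
    have "(LINT x|?M. \<bar>Y t (u0 x) - \<psi> x\<bar>) = (LINT x|?M. \<bar>u t x - \<psi> x\<bar>)" if t: "0 \<le> t" for t
    proof (rule integral_cong_AE)
      show "AE x in ?M. \<bar>Y t (u0 x) - \<psi> x\<bar> = \<bar>u t x - \<psi> x\<bar>"
        using u_eq[OF t] by eventually_elim simp
    qed (use Y_measurable[OF t] sol.u_measurable[OF t] \<psi>_integrable in auto)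
    then show "\<forall>\<^sub>F t in at_top. (LINT x|?M. \<bar>Y t (u0 x) - (indicator P.ones x + P.limit * indicator P.above x)\<bar>)
        = (LINT x|?M. \<bar>u t x - \<psi> x\<bar>)"
      unfolding \<psi>_eq eventually_at_top_linorder by blast
  qed
  show ?thesis
  proof (intro conjI ballI allI)
    fix x assume "x \<in> Omega_one \<Omega> u0"
    then show "((\<lambda>t. Y t (u0 x)) \<longlongrightarrow> 1) at_top"
      using P.Y_one by (intro tendsto_eventually) (auto simp: eventually_at_top_linorder Omega_one_def)
  next
    fix x assume "x \<in> Omega_plus \<Omega> u0"
    then have "1 < u0 x" by (simp add: Omega_plus_def)
    \<comment> \<open>The claim concerns every \<open>x\<close>, and \<open>u0 x\<close> may exceed
      \<open>B\<close> on a null set. A second instance with a larger bound covers this case;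
      \<open>limit\<close> is built from the measure and \<open>u0\<close> alone, so it is the same
      number.\<close>
    interpret Q: mass_preserving_flow ?M ?lam Y u0 "max B (u0 x)"
      by (rule preserving) (auto simp: B_def)
    show "((\<lambda>t. Y t (u0 x)) \<longlongrightarrow> lambda_infty \<Omega> u) at_top"
      using Q.Y_tendsto_limit[OF \<open>1 < u0 x\<close>] by (simp add: lam_inf)
  next
    fix \<phi> :: "real ^ 'n \<Rightarrow> real"
    have "\<phi> \<in> omega_limit \<Omega> u \<longleftrightarrow> (AE x in ?M. \<phi> x = \<psi> x)"
    proof
      assume "\<phi> \<in> omega_limit \<Omega> u"
      then obtain \<tau> :: "nat \<Rightarrow> real" where \<phi>: "integrable ?M \<phi>"
        and \<tau>: "\<And>n. 0 \<le> \<tau> n" "filterlim \<tau> at_top sequentially"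
        and lim: "(\<lambda>n. LINT x|?M. \<bar>u (\<tau> n) x - \<phi> x\<bar>) \<longlonglongrightarrow> 0"
        by (auto simp: omega_limit_def)
      \<comment> \<open>By the triangle inequality, the fixed L1 distance between
        \<open>\<phi>\<close> and \<open>\<psi>\<close> is at most this vanishing sum.\<close>
      have "(\<lambda>n. (LINT x|?M. \<bar>u (\<tau> n) x - \<phi> x\<bar>) + (LINT x|?M. \<bar>u (\<tau> n) x - \<psi> x\<bar>)) \<longlonglongrightarrow> 0 + 0"
        by (intro tendsto_add lim filterlim_compose[OF dist \<tau>(2)])
      moreover have "(LINT x|?M. \<bar>\<phi> x - \<psi> x\<bar>)
          \<le> (LINT x|?M. \<bar>u (\<tau> n) x - \<phi> x\<bar>) + (LINT x|?M. \<bar>u (\<tau> n) x - \<psi> x\<bar>)" for n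
      proof -
        note ints = \<phi> \<psi>_integrable u_integrable[OF \<tau>(1)]
        have "(LINT x|?M. \<bar>\<phi> x - \<psi> x\<bar>) \<le> (LINT x|?M. \<bar>u (\<tau> n) x - \<phi> x\<bar> + \<bar>u (\<tau> n) x - \<psi> x\<bar>)"
          using ints by (intro integral_mono) auto
        also have "\<dots> = (LINT x|?M. \<bar>u (\<tau> n) x - \<phi> x\<bar>) + (LINT x|?M. \<bar>u (\<tau> n) x - \<psi> x\<bar>)"
          using ints by (intro Bochner_Integration.integral_add) auto
        finally show ?thesis .
      qed
      ultimately have "(LINT x|?M. \<bar>\<phi> x - \<psi> x\<bar>) \<le> 0"
        by (intro LIMSEQ_le_const[where X = "\<lambda>n. (LINT x|?M. \<bar>u (\<tau> n) x - \<phi> x\<bar>) + (LINT x|?M. \<bar>u (\<tau> n) x - \<psi> x\<bar>)"]) auto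
      then have "(LINT x|?M. \<bar>\<phi> x - \<psi> x\<bar>) = 0"
        by (simp add: order_antisym)
      then have "AE x in ?M. \<bar>\<phi> x - \<psi> x\<bar> = 0"
        using \<phi> \<psi>_integrable by (subst (asm) integral_nonneg_eq_0_iff_AE) auto
      then show "AE x in ?M. \<phi> x = \<psi> x"
        by simp
    next
      assume ae: "AE x in ?M. \<phi> x = \<psi> x"
      have meas: "\<phi> \<in> borel_measurable ?M"
        by (rule measurable_lebesgue_on_AE[OF _ _ ae]) (use lmeas \<psi>_integrable in auto)
      then have "integrable ?M \<phi>"
        using ae \<psi>_integrable by (subst integrable_cong_AE[where g = \<psi>]) auto
      moreover have "(LINT x|?M. \<bar>u (real n) x - \<phi> x\<bar>) = (LINT x|?M. \<bar>u (real n) x - \<psi> x\<bar>)" for n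
      proof (rule integral_cong_AE)
        show "AE x in ?M. \<bar>u (real n) x - \<phi> x\<bar> = \<bar>u (real n) x - \<psi> x\<bar>"
          using ae by eventually_elim simp
      qed (use meas sol.u_measurable[of "real n"] \<psi>_integrable in auto)
      then have "(\<lambda>n. LINT x|?M. \<bar>u (real n) x - \<phi> x\<bar>) \<longlonglongrightarrow> 0"
        using filterlim_compose[OF dist filterlim_real_sequentially] by simp
      ultimately show "\<phi> \<in> omega_limit \<Omega> u"
        using filterlim_real_sequentially by (auto simp: omega_limit_def intro!: exI[of _ real])
    qed
    then show "\<phi> \<in> omega_limit \<Omega> u \<longleftrightarrow> (AE x in ?M. \<phi> x = indicat_real (Omega_one \<Omega> u0) x
        + lambda_infty \<Omega> u * indicat_real (Omega_plus \<Omega> u0) x)"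
      by (simp only: \<psi>_def)
  next
    fix l :: real
    \<comment> \<open>The equation is linear in \<open>l\<close> with positive slope, and
      \<open>limit\<close> is by definition its root.\<close>
    show "measure lebesgue (Omega_one \<Omega> u0) + l * measure lebesgue (Omega_plus \<Omega> u0)
        = (LINT x|?M. u0 x) \<longleftrightarrow> l = lambda_infty \<Omega> u"
      using P.measure_above_pos unfolding lam_inf P.limit_def ones above meas
      by (auto simp: field_simps)
  qed
qed

end
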